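(* Let $d\ge 1$, $w_1,\dots,w_d\in\mathcal H$, and $\bm w=(w_1,\dots,w_d)$. Then $$\begin{aligned} \zeta_{\rm Bh}'(0|\bm w)=\lim_{M\to\infty}\Biggl[&M^d(\log M-H_d)+\sum_{m=0}^{d}\frac{{}_dS_m^{(d)}(0)}{m!\,(d-m)!}F\bigl[x^{d-m}\log x\bigr]_{x=\bm w}M^{d-m}\\ &+(-1)^{d-1}\frac{{}_dS_d^{(d)}(0)}{d!}\log M-\sum_{\bm n\in\mathcal C_{M-1}\setminus\{\bm 0\}}\log(\bm n\cdot\bm w)\Biggr], \end{aligned}$$ where the limit is over positive integers $M$ and $\log M$ is the real logarithm.
   Context: $\mathcal H=\{z\in\mathbb C:\theta-\frac{\pi}{2}<\arg z<\theta+\frac{\pi}{2}\}$ is a fixed open half-plane ($\theta$ a fixed real angle), and $\log$ on $\mathcal H$ is a fixed holomorphic branch of the logarithm; $z^s=\exp(s\log z)$ for $z\in\mathcal H$. $\mathbb N_0=\{0,1,2,\dots\}$, $\bm n\cdot\bm w=\sum_{i=1}^d n_iw_i$, and $\mathcal C_M=\{0,1,\dots,M\}^d$. The homogeneous Barnes zeta function is $\zeta_{\rm Bh}(\alpha|\bm w)=\sum_{\bm n\in\mathbb N_0^d\setminus\{\bm 0\}}(\bm n\cdot\bm w)^{-\alpha}$ for $\Re(\alpha)>d$; it extends meromorphically in $\alpha$ to $\mathbb C$, with at most simple poles, located at $\alpha=1,\dots,d$. The prime in $\zeta_{\rm Bh}'$ denotes the derivative with respect to $\alpha$. For $\bm v\in\mathbb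 C^d$ and a function $g$ of $x$, $F[g(x)]_{x=\bm v}=\sum_{\emptyset\ne S\subseteq\{1,\dots,d\}}(-1)^{d-|S|}g\bigl(\sum_{i\in S}v_i\bigr)$. Harmonic numbers: $H_k=\sum_{i=1}^k 1/i$, $H_0=0$. The higher order Bernoulli polynomials $B_n(a|\bm w)$ are defined by $z^d{\rm e}^{az}\prod_{i=1}^d\frac{w_i}{{\rm e}^{w_iz}-1}=\sum_{n\ge0}B_n(a|\bm w)\frac{z^n}{n!}$ for $|z|<2\pi/\max_i|w_i|$. The Bernoullian functions ${}_dS_n(a)$ ($n\ge0$; dependence on $\bm w$ suppressed) are the polynomials in $a$ with ${}_dS_n(0)=0$ and ${}_dS_n'(a)=\frac{n!}{(n+d-1)!\,\prod_{i=1}^dw_i}B_{n+d-1}(a|\bm w)$; ${}_dS_m^{(d)}(0)$ is the $d$-th derivative in $a$ at $a=0$ (equivalently ${}_dS_m^{(d)}(0)=B_m(0|\bm w)/\prod_{i=1}^dw_i$). *)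

theory Defs
  imports "HOL-Complex_Analysis.Complex_Analysis"
begin

definition half_plane :: "real \<Rightarrow> complex set" where
  "half_plane \<theta> =
    {z. z \<noteq> 0 \<and> (\<exists>\<phi>. is_Arg z \<phi> \<and> \<theta> - pi / 2 < \<phi> \<and> \<phi> < \<theta> + pi / 2)}"

definition log_branch :: "(complex \<Rightarrow> complex) \<Rightarrow> complex set \<Rightarrow> bool" where
  "log_branch L A \<longleftrightarrow> L holomorphic_on A \<and> (\<forall>z\<in>A. exp (L z) = z)"

text \<open>
  A \<open>d\<close>-tuple of complex numbers is a function \<open>nat \<Rightarrow> complex\<close> of which only the values on
  \<open>{1..d}\<close> are used. Tuples of naturals index sums, so they are extensional functions on
  \<open>{1..d}\<close> in order that each tuple is counted exactly once.
\<close>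

definition nat_tuples :: "nat \<Rightarrow> (nat \<Rightarrow> nat) set" where
  "nat_tuples d = ({1..d} \<rightarrow>\<^sub>E UNIV)"

definition cube :: "nat \<Rightarrow> nat \<Rightarrow> (nat \<Rightarrow> nat) set" where
  "cube d M = ({1..d} \<rightarrow>\<^sub>E {0..M})"

definition zero_tuple :: "nat \<Rightarrow> nat \<Rightarrow> nat" where
  "zero_tuple d = (\<lambda>i\<in>{1..d}. 0)"

definition dot :: "nat \<Rightarrow> (nat \<Rightarrow> nat) \<Rightarrow> (nat \<Rightarrow> complex) \<Rightarrow> complex" where
  "dot d n w = (\<Sum>i=1..d. of_nat (n i) * w i)"

text \<open>
  The meromorphic continuation to the whole plane. A meromorphic function in the library's sense
  may take arbitrary values on a discrete set; \<open>nicely_meromorphic_on\<close> excludes this (removable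
  singularities are removed, the value at a pole is 0), so that the continuation is unique.
\<close>

definition barnes_zeta_h ::
    "(complex \<Rightarrow> complex) \<Rightarrow> nat \<Rightarrow> (nat \<Rightarrow> complex) \<Rightarrow> complex \<Rightarrow> complex" where
  "barnes_zeta_h L d w = (THE Z. Z nicely_meromorphic_on UNIV \<and>
     (\<forall>\<alpha>. Re \<alpha> > real d \<longrightarrow>
        Z \<alpha> = (\<Sum>\<^sub>\<infinity>n\<in>nat_tuples d - {zero_tuple d}. exp (- \<alpha> * L (dot d n w)))))"

definition alt_subset_sum ::
    "nat \<Rightarrow> (complex \<Rightarrow> complex) \<Rightarrow> (nat \<Rightarrow> complex) \<Rightarrow> complex" where
  "alt_subset_sum d g v = (\<Sum>S\<in>Pow {1..d} - {{}}. (-1) ^ (d - card S) * g (\<Sum>i\<in>S. v i))"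

text \<open>
  The generating function is read as a formal power series in \<open>z\<close>. The factor \<open>z ^ d\<close> is distributed
  over the product because only \<open>w\<^sub>i * z / (exp (w\<^sub>i * z) - 1)\<close>, and not
  \<open>w\<^sub>i / (exp (w\<^sub>i * z) - 1)\<close>, is a power series (for \<open>w\<^sub>i \<noteq> 0\<close>).
\<close>

definition bernoulli_poly :: "nat \<Rightarrow> (nat \<Rightarrow> complex) \<Rightarrow> nat \<Rightarrow> complex \<Rightarrow> complex" where
  "bernoulli_poly d w n a = fact n *
     fps_nth (fps_exp a * (\<Prod>i=1..d. fps_const (w i) * fps_X / (fps_exp (w i) - 1))) n"

definition bernoullian :: "nat \<Rightarrow> (nat \<Rightarrow> complex) \<Rightarrow> nat \<Rightarrow> complex poly" where
  "bernoullian d w n = (THE p. poly p 0 = 0 \<and>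
     (\<forall>a. poly (pderiv p) a =
        fact n / (fact (n + d - 1) * (\<Prod>i=1..d. w i)) * bernoulli_poly d w (n + d - 1) a))"

text \<open>The \<open>d\<close>-th derivative at 0 of the \<open>m\<close>-th Bernoullian function.\<close>

definition bernoullian_coeff :: "nat \<Rightarrow> (nat \<Rightarrow> complex) \<Rightarrow> nat \<Rightarrow> complex" where
  "bernoullian_coeff d w m = poly ((pderiv ^^ d) (bernoullian d w m)) 0"

end

theory Submission
  imports Defs
begin

text \<open>
  Write \<open>b\<^sub>m = B\<^sub>m(0|w) / (m! \<Prod> w\<^sub>i)\<close>. Since \<open>\<Sum> b\<^sub>m D\<^sup>m\<^sup>-\<^sup>d\<close> is formally inverse to the mixed difference
  operator \<open>\<Prod> (exp (w\<^sub>i D) - 1)\<close>, truncating it at \<open>m = N\<close> gives a function of \<open>x\<close> whose mixed difference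
  is \<open>x\<^sup>-\<^sup>\<alpha>\<close> up to an error of order \<open>|x|\<close> to the power \<open>- Re \<alpha> - N - 1\<close>. Mixed differences telescope over
  cubes of lattice points, so the partial sums of the zeta series over cubes, corrected by the alternating
  subset sum of that function at \<open>M w\<close>, converge locally uniformly for \<open>Re \<alpha> > d - N - 1\<close>. The limits
  for varying \<open>N\<close> agree and yield the meromorphic continuation. With \<open>N = d\<close> the convergence holds around
  \<open>\<alpha> = 0\<close>; differentiating there term by term gives the formula.
\<close>

section \<open>Mixed differences and Bernoulli coefficients\<close>

text \<open>The composition over \<open>I\<close> of the difference operators g(x + v i) - g(x),
  expanded into a sum over subsets.\<close>

definition mixed_diff ::
    "nat set \<Rightarrow> (nat \<Rightarrow> complex) \<Rightarrow> (complex \<Rightarrow> complex) \<Rightarrow> complex \<Rightarrow> complex" where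
  "mixed_diff I v g x = (\<Sum>S\<in>Pow I. (-1) ^ (card I - card S) * g (x + sum v S))"

lemma mixed_diff_empty [simp]: "mixed_diff {} v g x = g x"
  by (simp add: mixed_diff_def)

text \<open>Subsets of \<open>insert i I\<close> split by whether they contain \<open>i\<close>;
  leaving \<open>i\<close> out flips the sign.\<close>

lemma mixed_diff_insert:
  assumes "finite I" "i \<notin> I"
  shows "mixed_diff (insert i I) v g x = mixed_diff I v g (x + v i) - mixed_diff I v g x"
proof -
  let ?h = "\<lambda>S. (-1) ^ (card (insert i I) - card S) * g (x + sum v S)"
  have fin: "finite S" and ni: "i \<notin> S" and le: "card S \<le> card I" if "S \<in> Pow I" for S
    using that assms by (auto intro: finite_subset card_mono)
  have inj: "inj_on (insert i) (Pow I)"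
    using assms by (auto simp: inj_on_def)
  have "mixed_diff (insert i I) v g x = sum ?h (Pow I) + sum ?h (insert i ` Pow I)"
    unfolding mixed_diff_def Pow_insert using assms
    by (intro sum.union_disjoint) auto
  also have "sum ?h (Pow I) = - mixed_diff I v g x"
    unfolding mixed_diff_def sum_negf [symmetric]
    by (intro sum.cong refl) (use assms le in \<open>simp add: Suc_diff_le\<close>)
  also have "sum ?h (insert i ` Pow I) = mixed_diff I v g (x + v i)"
    unfolding mixed_diff_def sum.reindex[OF inj]
    by (intro sum.cong refl) (use assms fin ni in \<open>simp add: algebra_simps\<close>)
  finally show ?thesis by simp
qed

lemma mixed_diff_sum:
  "mixed_diff I v (\<lambda>x. \<Sum>m\<in>A. c m * f m x) x = (\<Sum>m\<in>A. c m * mixed_diff I v (f m) x)"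
  unfolding mixed_diff_def sum_distrib_left
  by (subst sum.swap) (intro sum.cong refl, simp add: algebra_simps)

lemma sum_PiE_insert:
  assumes "i \<notin> I"
  shows "(\<Sum>n\<in>PiE (insert i I) B. F n) = (\<Sum>k\<in>B i. \<Sum>n\<in>PiE I B. F (n(i := k)))"
proof -
  have "inj_on (\<lambda>(k, n). n(i := k)) (B i \<times> PiE I B)"
    using inj_combinator[OF assms, of B] by simp
  thus ?thesis
    by (simp add: PiE_insert_eq sum.reindex sum.cartesian_product case_prod_unfold)
qed

text \<open>Induction on \<open>I\<close>. For a fixed value k of the new coordinate the induction
  hypothesis sums over the others; what is left is a difference between k + 1 and k, which
  telescopes.\<close>

lemma mixed_diff_telescope:
  assumes "finite I"
  shows "(\<Sum>n\<in>PiE I (\<lambda>_. {..<M}). mixed_diff I v g (x + (\<Sum>i\<in>I. of_nat (n i) * v i)))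
         = mixed_diff I (\<lambda>i. of_nat M * v i) g x"
  using assms
proof (induction I arbitrary: x)
  case empty
  thus ?case by simp
next
  case (insert i I)
  let ?D = "mixed_diff I (\<lambda>i. of_nat M * v i) g"
  have "(\<Sum>n\<in>PiE (insert i I) (\<lambda>_. {..<M}).
           mixed_diff (insert i I) v g (x + (\<Sum>j\<in>insert i I. of_nat (n j) * v j)))
      = (\<Sum>k<M. \<Sum>n\<in>PiE I (\<lambda>_. {..<M}).
           mixed_diff (insert i I) v g (x + of_nat k * v i + (\<Sum>j\<in>I. of_nat (n j) * v j)))"
    unfolding sum_PiE_insert[OF insert.hyps(2)]
  proof (intro sum.cong refl)
    fix k n
    have "(\<Sum>j\<in>I. of_nat ((n(i := k)) j) * v j) = (\<Sum>j\<in>I. of_nat (n j) * v j)"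
      by (intro sum.cong refl) (use insert.hyps in auto)
    thus "mixed_diff (insert i I) v g (x + (\<Sum>j\<in>insert i I. of_nat ((n(i := k)) j) * v j))
        = mixed_diff (insert i I) v g (x + of_nat k * v i + (\<Sum>j\<in>I. of_nat (n j) * v j))"
      using insert.hyps by (simp add: algebra_simps)
  qed
  also have "\<dots> = (\<Sum>k<M. \<Sum>n\<in>PiE I (\<lambda>_. {..<M}).
           mixed_diff I v g (x + of_nat (Suc k) * v i + (\<Sum>j\<in>I. of_nat (n j) * v j))
         - mixed_diff I v g (x + of_nat k * v i + (\<Sum>j\<in>I. of_nat (n j) * v j)))"
    by (intro sum.cong refl) (simp add: mixed_diff_insert insert.hyps algebra_simps)
  also have "\<dots> = (\<Sum>k<M. ?D (x + of_nat (Suc k) * v i) - ?D (x + of_nat k * v i))"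
    unfolding sum_subtractf insert.IH ..
  also have "\<dots> = ?D (x + of_nat M * v i) - ?D (x + of_nat 0 * v i)"
    by (rule sum_lessThan_telescope)
  also have "\<dots> = mixed_diff (insert i I) (\<lambda>i. of_nat M * v i) g x"
    by (simp add: mixed_diff_insert insert.hyps)
  finally show ?case .
qed

text \<open>\<open>alt_subset_sum\<close> lacks only the empty subset, whose term does not depend on
  \<open>v\<close>.\<close>

lemma alt_subset_sum_eq_mixed_diff:
  "alt_subset_sum d g v = mixed_diff {1..d} v g 0 - (-1) ^ d * g 0"
proof -
  let ?h = "\<lambda>S. (-1) ^ (d - card S) * g (sum v S)"
  have "mixed_diff {1..d} v g 0 = sum ?h (Pow {1..d})"
    by (simp add: mixed_diff_def)
  also have "\<dots> = ?h {} + sum ?h (Pow {1..d} - {{}})"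
    by (intro sum.remove) auto
  finally show ?thesis
    by (simp add: alt_subset_sum_def)
qed

section \<open>Power series of the difference operator and Bernoulli coefficients\<close>

lemma prod_fps_const: "(\<Prod>i\<in>I. fps_const (f i)) = fps_const (\<Prod>i\<in>I. f i)"
  by (induction I rule: infinite_finite_induct) auto

lemma fps_nth_prod_0: "fps_nth (\<Prod>i\<in>I. f i) 0 = (\<Prod>i\<in>I. fps_nth (f i) 0)"
  by (induction I rule: infinite_finite_induct) auto

text \<open>The symbol of the mixed difference operator, with \<open>fps_X\<close> in place of
  differentiation.\<close>

definition diff_fps :: "nat \<Rightarrow> (nat \<Rightarrow> complex) \<Rightarrow> complex fps" where
  "diff_fps d w = (\<Prod>i=1..d. fps_exp (w i) - 1)"

text \<open>The generating function of B_n(a|w) / n! at a = 0.\<close>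

definition bernoulli_fps :: "nat \<Rightarrow> (nat \<Rightarrow> complex) \<Rightarrow> complex fps" where
  "bernoulli_fps d w = (\<Prod>i=1..d. fps_const (w i) * fps_X / (fps_exp (w i) - 1))"

text \<open>An extra factor \<open>fps_exp x\<close> carries the base point: in its presence
  \<open>fps_exp (w i) - 1\<close> acts on coefficients as the difference with step
  \<open>w i\<close>, so the induction follows \<open>mixed_diff_insert\<close>.\<close>

lemma fps_nth_diff_fps:
  "fps_nth (diff_fps d w) k = mixed_diff {1..d} w (\<lambda>x. x ^ k) 0 / fact k"
proof -
  have "fps_nth ((\<Prod>i\<in>I. fps_exp (w i) - 1) * fps_exp x) k
       = mixed_diff I w (\<lambda>x. x ^ k) x / fact k" if "finite I" for I x
    using that
  proof (induction I arbitrary: x)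
    case (insert i I)
    have "(\<Prod>i\<in>insert i I. fps_exp (w i) - 1) * fps_exp x =
          (\<Prod>i\<in>I. fps_exp (w i) - 1) * fps_exp (x + w i) -
          (\<Prod>i\<in>I. fps_exp (w i) - 1) * fps_exp x"
      using insert.hyps by (simp add: fps_exp_add_mult algebra_simps)
    thus ?case
      using insert by (simp add: mixed_diff_insert diff_divide_distrib)
  qed auto
  from this[of "{1..d}" 0] show ?thesis
    by (simp add: diff_fps_def)
qed

lemma bernoulli_fps_mult_diff_fps:
  assumes "\<And>i. i \<in> {1..d} \<Longrightarrow> w i \<noteq> 0"
  shows "bernoulli_fps d w * diff_fps d w = fps_const (\<Prod>i=1..d. w i) * fps_X ^ d"
proof -
  have eq: "fps_const c * fps_X / (fps_exp c - 1) * (fps_exp c - 1) = fps_const c * fps_X"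
    if "c \<noteq> 0" for c :: complex
  proof -
    \<comment> \<open>The quotient cancels only if the divisor divides, which is a comparison of
      subdegrees; both are 1 because \<open>c \<noteq> 0\<close>.\<close>
    have "subdegree (fps_exp c - 1) = 1"
      by (rule subdegreeI) (use that in auto)
    moreover from this have "fps_exp c - 1 \<noteq> 0" by auto
    moreover have "subdegree (fps_const c * fps_X) = 1"
      by (rule subdegreeI) (use that in auto)
    ultimately have "fps_exp c - 1 dvd fps_const c * fps_X"
      by (subst fps_dvd_iff) auto
    thus ?thesis by (rule dvd_div_mult_self)
  qed
  have "bernoulli_fps d w * diff_fps d w = (\<Prod>i=1..d. fps_const (w i) * fps_X)"
    unfolding bernoulli_fps_def diff_fps_def prod.distrib [symmetric]
    by (intro prod.cong refl eq assms)
  also have "\<dots> = fps_const (\<Prod>i=1..d. w i) * fps_X ^ d"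
    by (simp add: prod.distrib prod_fps_const)
  finally show ?thesis .
qed

text \<open>Each factor begins with \<open>w i\<close> times \<open>fps_X\<close>, so the product
  has no terms below degree d. This is why mixed differences of order d kill lower powers of
  x.\<close>

lemma diff_fps_factor:
  obtains E where "diff_fps d w = fps_X ^ d * E" "fps_nth E 0 = (\<Prod>i=1..d. w i)"
proof
  let ?E = "\<Prod>i=1..d. fps_shift 1 (fps_exp (w i) - 1)"
  have "fps_X * fps_shift 1 (fps_exp c - 1) = fps_exp c - 1" for c :: complex
    by (rule fps_ext) (auto simp: fps_eq_iff)
  hence "diff_fps d w = (\<Prod>i=1..d. fps_X * fps_shift 1 (fps_exp (w i) - 1))"
    by (simp add: diff_fps_def)
  thus "diff_fps d w = fps_X ^ d * ?E"
    by (simp add: prod.distrib)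
  show "fps_nth ?E 0 = (\<Prod>i=1..d. w i)"
    by (simp add: fps_nth_prod_0)
qed

lemma mixed_diff_power_0:
  assumes "k < d"
  shows "mixed_diff {1..d} w (\<lambda>x. x ^ k) 0 = 0"
proof -
  obtain E where "diff_fps d w = fps_X ^ d * E" by (rule diff_fps_factor)
  thus ?thesis
    using fps_nth_diff_fps[of d w k] assms by (simp add: fps_X_power_mult_nth)
qed

lemma mixed_diff_power_self:
  "mixed_diff {1..d} w (\<lambda>x. x ^ d) 0 = fact d * (\<Prod>i=1..d. w i)"
proof -
  obtain E where "diff_fps d w = fps_X ^ d * E" "fps_nth E 0 = (\<Prod>i=1..d. w i)"
    by (rule diff_fps_factor)
  hence "fps_nth (diff_fps d w) d = (\<Prod>i=1..d. w i)"
    by (simp only: fps_X_power_mult_nth) simp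
  thus ?thesis
    using fps_nth_diff_fps[of d w d] by (simp add: field_simps)
qed

text \<open>Among the powers up to d only the top one has a nonzero mixed difference; the value at k
  = 0 comes from the omitted empty subset, since 0 ^ 0 = 1.\<close>

lemma alt_subset_sum_power:
  assumes "k \<le> d" "d \<ge> 1"
  shows "alt_subset_sum d (\<lambda>x. x ^ k) w =
           (if k = 0 then (-1) ^ (d - 1) else if k = d then fact d * (\<Prod>i=1..d. w i) else 0)"
proof -
  have "(-1 :: complex) ^ d = - ((-1) ^ (d - 1))"
    using assms by (cases d) auto
  thus ?thesis
    using assms mixed_diff_power_0[of k d w] mixed_diff_power_self[of d w]
    by (auto simp: alt_subset_sum_eq_mixed_diff power_0_left)
qed

text \<open>For nonzero \<open>w i\<close> this is the coefficient of X^(m-d) in the Laurent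
  expansion of 1 / \<open>diff_fps d w\<close>.\<close>

definition bcoeff :: "nat \<Rightarrow> (nat \<Rightarrow> complex) \<Rightarrow> nat \<Rightarrow> complex" where
  "bcoeff d w m = fps_nth (bernoulli_fps d w) m / (\<Prod>i=1..d. w i)"

text \<open>The product identity read off coefficientwise. It is the cancellation that drives
  \<open>remainder_bound\<close>.\<close>

lemma bcoeff_convolution:
  assumes "\<And>i. i \<in> {1..d} \<Longrightarrow> w i \<noteq> 0"
  shows "(\<Sum>m\<le>K. bcoeff d w m * fps_nth (diff_fps d w) (K - m)) = (if K = d then 1 else 0)"
proof -
  have nz: "(\<Prod>i=1..d. w i) \<noteq> 0"
    using assms by auto
  have "(\<Sum>m\<le>K. fps_nth (bernoulli_fps d w) m * fps_nth (diff_fps d w) (K - m)) =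
          fps_nth (bernoulli_fps d w * diff_fps d w) K"
    by (simp add: fps_mult_nth atLeast0AtMost)
  also have "\<dots> = (if K = d then (\<Prod>i=1..d. w i) else 0)"
    by (subst bernoulli_fps_mult_diff_fps) (use assms in auto)
  finally show ?thesis
    using nz by (auto simp: bcoeff_def sum_divide_distrib [symmetric] split: if_splits)
qed

text \<open>In the convolution at K = d only m = 0 survives, because \<open>diff_fps\<close> starts
  in degree d.\<close>

lemma bcoeff_0:
  assumes "\<And>i. i \<in> {1..d} \<Longrightarrow> w i \<noteq> 0"
  shows "bcoeff d w 0 * (\<Prod>i=1..d. w i) = 1"
proof -
  obtain E where E: "diff_fps d w = fps_X ^ d * E" "fps_nth E 0 = (\<Prod>i=1..d. w i)"
    by (rule diff_fps_factor)
  have "(\<Sum>m\<le>d. bcoeff d w m * fps_nth (diff_fps d w) (d - m)) =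
        (\<Sum>m\<in>{0}. bcoeff d w m * fps_nth (diff_fps d w) (d - m))"
    by (intro sum.mono_neutral_right) (auto simp: E(1) fps_X_power_mult_nth)
  thus ?thesis
    using bcoeff_convolution[of d w d] assms E by (simp add: fps_X_power_mult_nth)
qed

lemma pderiv_sum: "pderiv (\<Sum>i\<in>I. f i) = (\<Sum>i\<in>I. pderiv (f i))"
  by (induction I rule: infinite_finite_induct) (auto simp: pderiv_add)

text \<open>The \<open>THE\<close> in \<open>bernoullian\<close> is resolved by a witness: the
  Bernoulli polynomial is expanded in powers of a (\<open>q\<close>) and integrated termwise
  (\<open>p\<close>). The d-th derivative at 0 then reads off the coefficient of a^d.\<close>

lemma bernoullian_coeff_eq:
  assumes "d \<ge> 1"
  shows "bernoullian_coeff d w m = fact m * bcoeff d w m"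
proof -
  let ?W = "\<Prod>i=1..d. w i"
  let ?c = "fact m / (fact (m + d - 1) * ?W) :: complex"
  let ?N = "m + d - 1"
  let ?B = "\<lambda>k. fps_nth (bernoulli_fps d w) k"
  let ?P = "\<lambda>p. poly p 0 = 0 \<and> (\<forall>a. poly (pderiv p) a = ?c * bernoulli_poly d w ?N a)"
  define q where "q = (\<Sum>k\<le>?N. monom (fact m / ?W * ?B (?N - k) / fact k) k)"
  define p where "p = (\<Sum>k\<le>?N. monom (fact m / ?W * ?B (?N - k) / fact k / of_nat (Suc k)) (Suc k))"
  have q: "poly q a = ?c * bernoulli_poly d w ?N a" for a
    unfolding q_def bernoulli_poly_def bernoulli_fps_def [symmetric]
    by (simp add: poly_sum poly_monom fps_mult_nth sum_distrib_left atLeast0AtMost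
             del: of_nat_Suc)
       (intro sum.cong refl, simp add: field_simps)
  have pq: "pderiv p = q"
    unfolding p_def q_def
    by (subst pderiv_sum, intro sum.cong refl) (simp add: pderiv_monom del: of_nat_Suc)
  have p0: "poly p 0 = 0"
    by (simp add: p_def poly_sum poly_monom)
  have "bernoullian d w m = p"
    unfolding bernoullian_def
  proof (rule the_equality)
    show "?P p" using p0 pq q by simp
  next
    fix r assume r: "?P r"
    hence "poly (pderiv r) = poly q"
      by (intro ext) (simp add: q)
    hence "pderiv (r - p) = 0"
      using pq by (simp add: poly_eq_poly_eq_iff pderiv_diff)
    hence "degree (r - p) = 0"
      by (simp add: pderiv_eq_0_iff)
    then obtain c where c: "r - p = [:c:]"
      by (rule degree_eq_zeroE)
    have "poly (r - p) 0 = 0"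
      using r p0 by simp
    with c show "r = p" by simp
  qed
  moreover have "coeff p d = fact m / ?W * ?B m / fact d"
  proof -
    \<comment> \<open>Only k = d - 1 integrates to a^d, and for it \<open>?N - k\<close> is
      m.\<close>
    have "coeff p d = (\<Sum>k\<le>?N. if k = d - 1 then fact m / ?W * ?B (?N - k) / fact k / of_nat (Suc k) else 0)"
      unfolding p_def coeff_sum
      by (intro sum.cong refl) (use assms in auto)
    also have "\<dots> = fact m / ?W * ?B m / fact (d - 1) / of_nat d"
      using assms by (subst sum.delta) auto
    also have "\<dots> = fact m / ?W * ?B m / fact d"
      using assms by (cases d) (simp_all add: mult_ac)
    finally show ?thesis .
  qed
  ultimately show ?thesis
    by (simp add: bernoullian_coeff_def poly_0_coeff_0 coeff_higher_pderiv bcoeff_def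
                  pochhammer_fact [symmetric])
qed

section \<open>The half-plane and the lattice cubes\<close>

text \<open>Rotation by \<open>cis (-\<theta>)\<close> gives the right half-plane: the condition on
  the argument becomes positivity of a cosine. Conversely, the principal argument of the rotated
  point plus \<theta> is an admissible argument.\<close>

lemma half_plane_eq: "half_plane \<theta> = {z. 0 < Re (cis (-\<theta>) * z)}"
proof (intro set_eqI iffI)
  fix z assume "z \<in> half_plane \<theta>"
  then obtain \<phi> where z: "z \<noteq> 0" "is_Arg z \<phi>" "\<theta> - pi / 2 < \<phi>" "\<phi> < \<theta> + pi / 2"
    by (auto simp: half_plane_def)
  hence "z = of_real (norm z) * cis \<phi>"
    by (simp add: is_Arg_def cis_conv_exp)
  hence "cis (-\<theta>) * z = of_real (norm z) * cis (\<phi> - \<theta>)"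
    by (metis add.commute cis_mult mult.left_commute uminus_add_conv_diff)
  hence "Re (cis (-\<theta>) * z) = norm z * cos (\<phi> - \<theta>)"
    by simp
  moreover have "cos (\<phi> - \<theta>) > 0"
    using z by (intro cos_gt_zero_pi) auto
  ultimately show "z \<in> {z. 0 < Re (cis (-\<theta>) * z)}"
    using z by simp
next
  fix z assume "z \<in> {z. 0 < Re (cis (-\<theta>) * z)}"
  hence pos: "0 < Re (cis (-\<theta>) * z)" by simp
  define y where "y = cis (-\<theta>) * z"
  have y: "y \<noteq> 0" "\<bar>Im (Ln y)\<bar> < pi / 2"
    using pos Re_Ln_pos_lt_imp[of y] by (auto simp: y_def)
  have nz: "z \<noteq> 0"
    using pos by auto
  have "z = cis \<theta> * y"
    by (simp add: y_def cis_mult flip: mult.assoc)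
  also have "y = of_real (norm y) * cis (Im (Ln y))"
    using is_Arg_eqI y by (metis Arg_eq Arg_eq_Im_Ln cis_conv_exp)
  finally have "z = of_real (norm y) * cis (\<theta> + Im (Ln y))"
    by (simp add: cis_mult [symmetric] mult_ac)
  moreover have "norm y = norm z"
    by (simp add: y_def norm_mult)
  ultimately have "is_Arg z (\<theta> + Im (Ln y))"
    by (simp add: is_Arg_def cis_conv_exp)
  thus "z \<in> half_plane \<theta>"
    using y nz unfolding half_plane_def by (auto intro!: exI[of _ "\<theta> + Im (Ln y)"])
qed

lemma half_plane_nonzero: "x \<in> half_plane \<theta> \<Longrightarrow> x \<noteq> 0"
  by (auto simp: half_plane_eq)

lemma open_half_plane: "open (half_plane \<theta>)"
  unfolding half_plane_eq by (intro open_Collect_less continuous_intros)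

lemma half_plane_add:
  "x \<in> half_plane \<theta> \<Longrightarrow> y \<in> half_plane \<theta> \<Longrightarrow> x + y \<in> half_plane \<theta>"
  by (auto simp: half_plane_eq algebra_simps)

lemma half_plane_scale:
  assumes "x \<in> half_plane \<theta>" "t > 0"
  shows "of_real t * x \<in> half_plane \<theta>"
proof -
  have "Re (cis (-\<theta>) * (of_real t * x)) = t * Re (cis (-\<theta>) * x)"
    by (simp add: algebra_simps)
  thus ?thesis
    using assms by (simp add: half_plane_eq)
qed

lemma convex_half_plane: "convex (half_plane \<theta>)"
proof (rule convexI)
  fix x y :: complex and s t :: real
  assume xy: "x \<in> half_plane \<theta>" "y \<in> half_plane \<theta>" and st: "0 \<le> s" "0 \<le> t" "s + t = 1"
  show "s *\<^sub>R x + t *\<^sub>R y \<in> half_plane \<theta>"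
  proof (cases "s = 0 \<or> t = 0")
    case True
    thus ?thesis using xy st by auto
  next
    case False
    thus ?thesis
      using half_plane_add[OF half_plane_scale half_plane_scale, of x \<theta> s y t] xy st
      by (simp add: scaleR_conv_of_real)
  qed
qed

section \<open>Lattice cubes and their shells\<close>

lemma card_cube: "card (cube d M) = (M + 1) ^ d"
  by (simp add: cube_def card_PiE)

lemma finite_cube [simp, intro]: "finite (cube d M)"
  by (simp add: cube_def finite_PiE)

lemma cube_mono: "M \<le> M' \<Longrightarrow> cube d M \<subseteq> cube d M'"
  unfolding cube_def by (intro PiE_mono) auto

lemma zero_tuple_in_cube [simp, intro]: "zero_tuple d \<in> cube d M"
  by (auto simp: zero_tuple_def cube_def)

lemma cube_0: "cube d 0 = {zero_tuple d}"
  by (auto simp: cube_def zero_tuple_def PiE_eq_singleton)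

lemma dot_zero_tuple [simp]: "dot d (zero_tuple d) w = 0"
  by (simp add: dot_def zero_tuple_def)

lemma nat_tuples_eq_Union_cube: "nat_tuples d = (\<Union>M. cube d M)"
proof (intro equalityI subsetI)
  fix n assume n: "n \<in> nat_tuples d"
  define M where "M = Max (n ` {1..d})"
  have "n i \<le> M" if "i \<in> {1..d}" for i
    using that by (auto simp: M_def)
  hence "n \<in> cube d M"
    using n by (auto simp: nat_tuples_def cube_def PiE_iff)
  thus "n \<in> (\<Union>M. cube d M)" by blast
qed (auto simp: nat_tuples_def cube_def PiE_iff)

abbreviation shell :: "nat \<Rightarrow> nat \<Rightarrow> (nat \<Rightarrow> nat) set" where
  "shell d M \<equiv> cube d (Suc M) - cube d M"

lemma card_shell_le: "card (shell d M) \<le> d * (M + 2) ^ (d - 1)"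
proof -
  \<comment> \<open>A discrete mean value inequality. It brings the exponent of the shell size down
    to d - 1.\<close>
  have "Suc x ^ d \<le> x ^ d + d * Suc x ^ (d - 1)" for x :: nat
  proof (induction d)
    case (Suc d)
    have "Suc x ^ Suc d = Suc x ^ d + x * Suc x ^ d" by simp
    also have "x * Suc x ^ d \<le> x * (x ^ d + d * Suc x ^ (d - 1))"
      using Suc.IH by (rule mult_le_mono2)
    also have "\<dots> = x ^ Suc d + d * (x * Suc x ^ (d - 1))"
      by (simp add: algebra_simps)
    also have "d * (x * Suc x ^ (d - 1)) \<le> d * Suc x ^ d"
    proof (cases d)
      case (Suc e)
      have "x * Suc x ^ e \<le> Suc x * Suc x ^ e" by simp
      thus ?thesis unfolding Suc by (intro mult_le_mono2) simp
    qed auto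
    finally show ?case by simp
  qed auto
  moreover have "card (shell d M) = (M + 2) ^ d - (M + 1) ^ d"
    using card_Diff_subset[of "cube d M" "cube d (Suc M)"] cube_mono[of M "Suc M" d]
    by (simp add: card_cube)
  ultimately show ?thesis
    by (metis (no_types) Suc_eq_plus1 add_2_eq_Suc' diff_le_mono diff_add_inverse le_diff_conv add.commute)
qed

text \<open>\<open>cube d 0\<close> is the origin alone, so the shells partition the nonzero points
  of a cube. Later estimates are made shell by shell.\<close>

lemma sum_cube_shells:
  fixes F :: "_ \<Rightarrow> 'b :: ab_group_add"
  shows "sum F (cube d M - {zero_tuple d}) = (\<Sum>k<M. sum F (shell d k))"
proof (induction M)
  case 0
  thus ?case by (simp add: cube_0)
next
  case (Suc M)
  have "cube d (Suc M) - {zero_tuple d} = (cube d M - {zero_tuple d}) \<union> shell d M"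
    using cube_mono[of M "Suc M" d] zero_tuple_in_cube[of d M] by auto
  moreover have "(cube d M - {zero_tuple d}) \<inter> shell d M = {}" by auto
  ultimately have "sum F (cube d (Suc M) - {zero_tuple d}) =
                   sum F (cube d M - {zero_tuple d}) + sum F (shell d M)"
    by (simp add: sum.union_disjoint)
  with Suc.IH show ?case by simp
qed

lemma mixed_diff_cube:
  "(\<Sum>n\<in>cube d M. mixed_diff {1..d} w g (dot d n w)) =
     mixed_diff {1..d} (\<lambda>i. of_nat (Suc M) * w i) g 0"
proof -
  \<comment> \<open>Entries from 0 to M are \<open>Suc M\<close> values, hence the step
    \<open>Suc M * w i\<close> after telescoping.\<close>
  have "cube d M = PiE {1..d} (\<lambda>_. {..<Suc M})"
    by (simp add: cube_def lessThan_Suc_atMost atMost_atLeast0)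
  thus ?thesis
    using mixed_diff_telescope[of "{1..d}" w g 0 "Suc M"] by (simp add: dot_def)
qed

text \<open>The \<open>g 0\<close> terms of the two cubes cancel, so the value of \<open>g\<close>
  at the origin, where the logarithm has no meaning, is irrelevant.\<close>

lemma mixed_diff_shell:
  "(\<Sum>n\<in>shell d M. mixed_diff {1..d} w g (dot d n w)) =
     alt_subset_sum d g (\<lambda>i. of_nat (Suc (Suc M)) * w i) - alt_subset_sum d g (\<lambda>i. of_nat (Suc M) * w i)"
proof -
  have "(\<Sum>n\<in>shell d M. mixed_diff {1..d} w g (dot d n w)) =
        (\<Sum>n\<in>cube d (Suc M). mixed_diff {1..d} w g (dot d n w)) -
        (\<Sum>n\<in>cube d M. mixed_diff {1..d} w g (dot d n w))"
    by (intro sum_diff cube_mono) auto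
  thus ?thesis
    by (simp only: mixed_diff_cube alt_subset_sum_eq_mixed_diff) simp
qed

lemma eventually_subset_cube:
  assumes "finite F" "F \<subseteq> nat_tuples d"
  shows "eventually (\<lambda>M. F \<subseteq> cube d M) sequentially"
proof -
  have "eventually (\<lambda>M. n \<in> cube d M) sequentially" if n: "n \<in> F" for n
  proof -
    obtain M0 where M0: "n \<in> cube d M0"
      using n assms(2) unfolding nat_tuples_eq_Union_cube by blast
    from eventually_ge_at_top[of M0] show ?thesis
      by eventually_elim (use M0 cube_mono in blast)
  qed
  hence "eventually (\<lambda>M. \<forall>n\<in>F. n \<in> cube d M) sequentially"
    using assms by (intro eventually_ball_finite) auto
  thus ?thesis by (simp add: subset_eq)
qed

text \<open>Every finite set of tuples lies in all large cubes, so an unconditional sum can be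
  computed along cubes.\<close>

lemma filterlim_cube:
  "filterlim (\<lambda>M. cube d M - {zero_tuple d})
     (finite_subsets_at_top (nat_tuples d - {zero_tuple d})) sequentially"
  unfolding filterlim_finite_subsets_at_top
proof safe
  fix X assume X: "finite X" "X \<subseteq> nat_tuples d - {zero_tuple d}"
  have "eventually (\<lambda>M. X \<subseteq> cube d M) sequentially"
    using X by (intro eventually_subset_cube) auto
  thus "eventually (\<lambda>M. finite (cube d M - {zero_tuple d}) \<and> X \<subseteq> cube d M - {zero_tuple d} \<and>
          cube d M - {zero_tuple d} \<subseteq> nat_tuples d - {zero_tuple d}) sequentially"
    by eventually_elim (use X in \<open>auto simp: nat_tuples_eq_Union_cube\<close>)
qed

section \<open>Uniqueness of nicely meromorphic continuations\<close>

lemma nicely_meromorphic_eq_remove_sings: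
  assumes "f nicely_meromorphic_on A" "z \<in> A"
  shows "remove_sings f z = f z"
  using assms unfolding nicely_meromorphic_on_def by force

text \<open>By the identity theorem the difference vanishes once its singularities are removed. Then
  \<open>f\<close> and \<open>g\<close> agree in a punctured neighbourhood of each point, and a
  nicely meromorphic function is determined at a point by its values around it.\<close>

lemma nicely_meromorphic_unique:
  assumes f: "f nicely_meromorphic_on UNIV" and g: "g nicely_meromorphic_on UNIV"
    and eq: "\<And>z. z \<in> S \<Longrightarrow> f z = g z" and S: "open S" "S \<noteq> {}"
  shows "f = g"
proof
  fix z
  obtain z0 where z0: "z0 \<in> S" using S by auto
  \<comment> \<open>The difference need not be nicely meromorphic, since poles may cancel; hence the
    detour through \<open>remove_sings h\<close>.\<close>
  define h where "h = (\<lambda>z. f z - g z)"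
  have h: "h meromorphic_on UNIV"
    using f g unfolding h_def nicely_meromorphic_on_def by (auto intro: meromorphic_intros)
  have "remove_sings h x = 0" if "x \<in> S" for x
  proof -
    have "eventually (\<lambda>y. y \<in> S) (at x)"
      using S that by (simp add: eventually_at_in_open')
    hence "eventually (\<lambda>y. h y = 0) (at x)"
      by eventually_elim (simp add: h_def eq)
    thus ?thesis
      by (intro remove_sings_eqI tendsto_eventually)
  qed
  moreover have "eventually (\<lambda>y. y \<in> S) (at z0)"
    using S z0 by (simp add: eventually_at_in_open')
  ultimately have "eventually (\<lambda>y. remove_sings h y = 0) (at z0)"
    by (auto elim: eventually_mono)
  hence freq: "frequently (\<lambda>y. remove_sings h y = 0) (at z0)"
    by (intro eventually_frequently) auto
  have 0: "remove_sings h y = 0" for y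
    by (rule frequently_eq_meromorphic_imp_constant
               [OF freq remove_sings_nicely_meromorphic[OF h] open_UNIV connected_UNIV]) simp_all
  have "isolated_singularity_at h z"
    using meromorphic_on_isolated_singularity meromorphic_on_subset[OF h, of "{z}"] by simp
  from eventually_remove_sings_eq_at[OF this] have "eventually (\<lambda>y. f y = g y) (at z)"
    by eventually_elim (use 0 in \<open>simp add: h_def\<close>)
  hence "remove_sings f z = remove_sings g z"
    by (rule remove_sings_cong) auto
  thus "f z = g z"
    using nicely_meromorphic_eq_remove_sings f g by simp
qed

section \<open>Asymptotic antidifferences of powers\<close>

locale barnes =
  fixes \<theta> :: real and L :: "complex \<Rightarrow> complex" and d :: nat and w :: "nat \<Rightarrow> complex"
  assumes L: "log_branch L (half_plane \<theta>)"
    and d_pos: "d \<ge> 1"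
    and w_in: "\<And>i. i \<in> {1..d} \<Longrightarrow> w i \<in> half_plane \<theta>"
begin

abbreviation H :: "complex set" where "H \<equiv> half_plane \<theta>"

lemma w_nz: "i \<in> {1..d} \<Longrightarrow> w i \<noteq> 0"
  using w_in half_plane_nonzero by blast

section \<open>The branch of the logarithm\<close>

lemma exp_L: "x \<in> H \<Longrightarrow> exp (L x) = x"
  using L by (auto simp: log_branch_def)

lemma L_deriv:
  assumes "x \<in> H"
  shows "(L has_field_derivative 1 / x) (at x)"
proof -
  have "(L has_field_derivative deriv L x) (at x)"
    using L assms open_half_plane by (auto simp: log_branch_def holomorphic_derivI)
  hence "((\<lambda>x. exp (L x)) has_field_derivative exp (L x) * deriv L x) (at x)"
    by (rule DERIV_chain[OF DERIV_exp, unfolded o_def])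
  hence "((\<lambda>x. x) has_field_derivative exp (L x) * deriv L x) (at x)"
    by (rule has_field_derivative_transform_within_open[OF _ open_half_plane assms])
       (auto simp: exp_L)
  hence "x * deriv L x = 1"
    using DERIV_unique[OF _ DERIV_ident] assms by (auto simp: exp_L)
  hence "deriv L x = 1 / x"
    using half_plane_nonzero[OF assms] by (simp add: field_simps)
  with \<open>(L has_field_derivative deriv L x) (at x)\<close> show ?thesis
    by simp
qed

text \<open>On the convex half-plane \<open>L\<close> and the principal logarithm of the rotated
  point have the same derivative 1 / x, so they differ by a constant, and the principal logarithm
  respects positive scaling.\<close>

lemma L_scale:
  assumes "x \<in> H" "t > 0"
  shows "L (of_real t * x) = of_real (ln t) + L x"
proof -
  let ?u = "cis (-\<theta>)"
  have "\<exists>c. \<forall>x\<in>H. L x - Ln (?u * x) = c"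
  proof (rule has_field_derivative_zero_constant[OF convex_half_plane])
    fix x assume x: "x \<in> H"
    hence "?u * x \<notin> \<real>\<^sub>\<le>\<^sub>0"
      by (auto simp: half_plane_eq complex_nonpos_Reals_iff)
    hence "((\<lambda>x. L x - Ln (?u * x)) has_field_derivative 0) (at x)"
      using x half_plane_nonzero[OF x]
      by (auto intro!: derivative_eq_intros L_deriv simp: field_simps cis_mult)
    thus "((\<lambda>x. L x - Ln (?u * x)) has_field_derivative 0) (at x within H)"
      by (rule has_field_derivative_at_within)
  qed
  then obtain c where c: "\<And>x. x \<in> H \<Longrightarrow> L x = c + Ln (?u * x)"
    by (metis diff_add_cancel)
  have "Ln (of_real t * (?u * x)) = of_real (ln t) + Ln (?u * x)"
    using assms half_plane_nonzero[OF assms(1)]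
    by (subst Ln_times_of_real) (auto simp: Ln_of_real)
  thus ?thesis
    using c[OF assms(1)] c[OF half_plane_scale[OF assms]] by (simp add: mult_ac)
qed

lemma sum_w_in:
  assumes "S \<subseteq> {1..d}" "S \<noteq> {}"
  shows "sum w S \<in> H"
proof -
  have "finite S" using assms finite_subset by blast
  from this assms(2,1) show ?thesis
  proof (induction S rule: finite_ne_induct)
    case (insert i S)
    thus ?case using half_plane_add[OF w_in[of i], of "sum w S"] by simp
  qed (use w_in in auto)
qed

text \<open>
  On the shell of radius \<open>M + 1\<close> the points in question are \<open>M + 1\<close> times elements of a compact
  subset of the half-plane, on which \<open>L\<close> is bounded.
\<close>
lemma L_bound:
  obtains \<Lambda> where "\<Lambda> \<ge> 0"
    "\<And>M n S t. n \<in> shell d M \<Longrightarrow> S \<subseteq> {1..d} \<Longrightarrow> 0 \<le> t \<Longrightarrow> t \<le> 1 \<Longrightarrow>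
       dot d n w + of_real t * sum w S \<in> H \<and>
       norm (L (dot d n w + of_real t * sum w S) - of_real (ln (real (Suc M)))) \<le> \<Lambda>"
proof -
  let ?u = "cis (-\<theta>)"
  let ?r = "\<lambda>z. Re (?u * z)"
  define c where "c = Min ((\<lambda>i. ?r (w i)) ` {1..d})"
  define C where "C = (\<Sum>i=1..d. norm (w i))"
  have c: "c > 0"
    using d_pos w_in by (subst c_def, subst Min_gr_iff) (auto simp: half_plane_eq)
  have c_le: "c \<le> ?r (w i)" if "i \<in> {1..d}" for i
    using that by (auto simp: c_def)
  \<comment> \<open>The disc radius allows \<open>C\<close> for the lattice point divided by
    \<open>Suc M\<close> and another \<open>C\<close> for the shift.\<close>
  let ?K = "{z. c \<le> ?r z} \<inter> cball 0 (2 * C)"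
  have "compact ?K"
    by (intro closed_Int_compact closed_Collect_le continuous_intros compact_cball)
  moreover have KH: "?K \<subseteq> H"
    using c by (auto simp: half_plane_eq)
  hence "continuous_on ?K L"
    using L by (auto simp: log_branch_def intro: holomorphic_on_imp_continuous_on continuous_on_subset)
  ultimately have "bounded (L ` ?K)"
    by (intro compact_imp_bounded compact_continuous_image)
  then obtain \<Lambda> where \<Lambda>: "\<Lambda> > 0" "\<And>z. z \<in> ?K \<Longrightarrow> norm (L z) \<le> \<Lambda>"
    by (auto simp: bounded_pos)
  have "dot d n w + of_real t * sum w S \<in> H \<and>
        norm (L (dot d n w + of_real t * sum w S) - of_real (ln (real (Suc M)))) \<le> \<Lambda>"
    if n: "n \<in> shell d M" and S: "S \<subseteq> {1..d}" and t: "0 \<le> t" "t \<le> 1" for M n S t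
  proof -
    let ?x = "dot d n w + of_real t * sum w S"
    define z where "z = ?x / of_nat (Suc M)"
    have r_pos: "?r (w i) \<ge> 0" if "i \<in> {1..d}" for i
      using w_in[OF that] by (simp add: half_plane_eq)
    have r_sum: "?r (\<Sum>i\<in>A. f i) = (\<Sum>i\<in>A. ?r (f i))" for f and A :: "nat set"
      by (simp only: sum_distrib_left Re_sum)
    have r_scale: "?r (of_real a * y) = a * ?r y" for a y
      by (simp add: algebra_simps)
    \<comment> \<open>Some coordinate of a shell point equals \<open>Suc M\<close>; as all rotated
      real parts are nonnegative, it alone forces the lower bound \<open>Suc M * c\<close>.\<close>
    obtain j where j: "j \<in> {1..d}" "n j = Suc M"
      using n by (auto simp: cube_def PiE_iff le_Suc_eq)
    have "real (Suc M) * c \<le> real (n j) * ?r (w j)"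
      using c_le[OF j(1)] j(2) by (simp add: mult_left_mono)
    also have "\<dots> \<le> (\<Sum>i=1..d. real (n i) * ?r (w i))"
      using j r_pos by (intro member_le_sum) auto
    also have "\<dots> = ?r (dot d n w)"
      unfolding dot_def r_sum by (intro sum.cong refl) (use r_scale[of "real (n _)"] in simp)
    also have "?r (sum w S) \<ge> 0"
      unfolding r_sum by (rule sum_nonneg) (use S r_pos in blast)
    hence "?r (dot d n w) \<le> ?r (dot d n w) + t * ?r (sum w S)"
      using t by simp
    also have "\<dots> = ?r ?x"
      using r_scale[of t] by (simp add: distrib_left)
    finally have 1: "real (Suc M) * c \<le> ?r ?x" .
    have x: "?x = of_real (real (Suc M)) * z"
      by (simp add: z_def del: of_nat_Suc)
    have "real (Suc M) * c \<le> real (Suc M) * ?r z"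
      using 1 unfolding x r_scale .
    hence "c \<le> ?r z"
      by (simp del: of_nat_Suc)
    moreover have "norm z \<le> 2 * C"
    proof -
      have "norm ?x \<le> norm (dot d n w) + norm (of_real t * sum w S)"
        by (rule norm_triangle_ineq)
      also have "norm (dot d n w) \<le> (\<Sum>i=1..d. real (Suc M) * norm (w i))"
        unfolding dot_def
      proof (rule sum_norm_le)
        fix i assume "i \<in> {1..d}"
        hence "n i \<le> Suc M" using n by (auto simp: cube_def PiE_iff)
        thus "norm (of_nat (n i) * w i) \<le> real (Suc M) * norm (w i)"
          by (simp add: norm_mult mult_right_mono del: of_nat_Suc)
      qed
      also have "\<dots> = real (Suc M) * C"
        by (simp add: C_def sum_distrib_left)
      also have "norm (of_real t * sum w S) \<le> real (Suc M) * C"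
      proof -
        have "norm (sum w S) \<le> (\<Sum>i\<in>S. norm (w i))" by (rule norm_sum)
        also have "\<dots> \<le> C" unfolding C_def by (rule sum_mono2) (use S in auto)
        finally have "t * norm (sum w S) \<le> real (Suc M) * C"
          using t by (intro mult_mono) auto
        thus ?thesis using t by (simp add: norm_mult)
      qed
      finally have "norm ?x \<le> real (Suc M) * (2 * C)" by (simp add: algebra_simps)
      thus ?thesis
        by (simp add: z_def norm_divide field_simps del: of_nat_Suc)
    qed
    ultimately have zK: "z \<in> ?K" by simp
    hence zH: "z \<in> H" using KH by blast
    have "L ?x = of_real (ln (real (Suc M))) + L z"
      unfolding x by (rule L_scale) (use zH in auto)
    moreover have "?x \<in> H"
      unfolding x by (rule half_plane_scale) (use zH in auto)
    ultimately show ?thesis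
      using \<Lambda>(2)[OF zK] by simp
  qed
  thus ?thesis
    using that[of \<Lambda>] \<Lambda>(1) by auto
qed

section \<open>Truncated antidifferences and their errors\<close>

definition falling :: "nat \<Rightarrow> complex \<Rightarrow> complex" where
  "falling k \<alpha> = (\<Prod>j<k. of_nat d - of_nat j - \<alpha>)"

text \<open>
  \<open>dpow k \<alpha>\<close> is the \<open>k\<close>-th derivative of \<open>x\<^sup>d\<^sup>-\<^sup>\<alpha>\<close>. Starting from \<open>x\<^sup>d\<^sup>-\<^sup>\<alpha>\<close> rather than from the \<open>d\<close>-fold
  antiderivative of \<open>x\<^sup>-\<^sup>\<alpha>\<close> costs the factor \<open>falling d \<alpha>\<close> but keeps everything entire in \<open>\<alpha>\<close>.
\<close>
definition dpow :: "nat \<Rightarrow> complex \<Rightarrow> complex \<Rightarrow> complex" where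
  "dpow k \<alpha> x = falling k \<alpha> * exp ((of_nat d - of_nat k - \<alpha>) * L x)"

text \<open>Summed formally over all m, this would have mixed difference
  \<open>dpow d \<alpha>\<close>, that is, \<open>falling d \<alpha>\<close> times the power of x
  with exponent -\<alpha>.\<close>

definition antidiff :: "nat \<Rightarrow> complex \<Rightarrow> complex \<Rightarrow> complex" where
  "antidiff N \<alpha> x = (\<Sum>m\<le>N. bcoeff d w m * dpow m \<alpha> x)"

text \<open>The cube sum minus its expected growth. The correction is taken at \<open>Suc M\<close>
  because entries up to M make \<open>Suc M\<close> steps.\<close>

definition approx :: "nat \<Rightarrow> nat \<Rightarrow> complex \<Rightarrow> complex" where
  "approx N M \<alpha> = falling d \<alpha> * (\<Sum>n\<in>cube d M - {zero_tuple d}. exp (- \<alpha> * L (dot d n w)))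
             - alt_subset_sum d (antidiff N \<alpha>) (\<lambda>i. of_nat (Suc M) * w i)"

lemma dpow_deriv:
  assumes "x \<in> H"
  shows "(dpow k \<alpha> has_field_derivative dpow (Suc k) \<alpha> x) (at x)"
proof -
  let ?s = "of_nat d - of_nat k - \<alpha>"
  have "exp (?s * L x - L x) = exp (?s * L x) / x"
    using assms by (simp add: exp_diff exp_L)
  hence "dpow (Suc k) \<alpha> x = falling k \<alpha> * (exp (?s * L x) * (?s * (1 / x)))"
    by (simp add: dpow_def falling_def algebra_simps)
  moreover have "dpow k \<alpha> = (\<lambda>x. falling k \<alpha> * exp (?s * L x))"
    by (rule ext) (simp add: dpow_def)
  ultimately show ?thesis
    using assms by (auto intro!: derivative_eq_intros L_deriv)
qed

text \<open>Each \<open>dpow m\<close> is expanded at x by Taylor's formula. Collecting the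
  polynomial parts by derivative order K gives \<open>dpow K\<close> times a convolution that
  vanishes unless K = d; only Taylor remainders are left. \<open>C\<close> is independent of
  \<alpha> and x, as uniform convergence requires.\<close>

lemma remainder_bound:
  obtains C where "C \<ge> 0"
    "\<And>\<alpha> x B. (\<And>S t. S \<subseteq> {1..d} \<Longrightarrow> 0 \<le> t \<Longrightarrow> t \<le> 1 \<Longrightarrow>
        x + of_real t * sum w S \<in> H \<and> norm (dpow (d + N + 1) \<alpha> (x + of_real t * sum w S)) \<le> B) \<Longrightarrow>
      norm (dpow d \<alpha> x - mixed_diff {1..d} w (antidiff N \<alpha>) x) \<le> C * B"
proof -
  define c where "c = (\<lambda>m S. norm (bcoeff d w m) * (norm (sum w S) ^ Suc (d + N - m) / fact (d + N - m)))"
  define C where "C = (\<Sum>m\<le>N. \<Sum>S\<in>Pow {1..d}. c m S)"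
  have "norm (dpow d \<alpha> x - mixed_diff {1..d} w (antidiff N \<alpha>) x) \<le> C * B"
    if *: "\<And>S t. S \<subseteq> {1..d} \<Longrightarrow> 0 \<le> t \<Longrightarrow> t \<le> 1 \<Longrightarrow>
        x + of_real t * sum w S \<in> H \<and> norm (dpow (d + N + 1) \<alpha> (x + of_real t * sum w S)) \<le> B"
    for \<alpha> x B
  proof -
    let ?sg = "\<lambda>S :: nat set. (-1) ^ (d - card S) :: complex"
    let ?b = "bcoeff d w" and ?D = "fps_nth (diff_fps d w)"
    \<comment> \<open>The order of expansion depends on m so that all remainders involve the same
      derivative \<open>dpow (d + N + 1)\<close>.\<close>
    define tay where "tay = (\<lambda>m S. \<Sum>i\<le>d + N - m. dpow (m + i) \<alpha> x * (sum w S) ^ i / fact i)"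
    define e where "e = (\<lambda>m S. dpow m \<alpha> (x + sum w S) - tay m S)"
    have e_bound: "norm (e m S) \<le> B * norm (sum w S) ^ Suc (d + N - m) / fact (d + N - m)"
      if m: "m \<le> N" and S: "S \<subseteq> {1..d}" for m S
    proof -
      let ?seg = "closed_segment x (x + sum w S)"
      have seg: "y \<in> H \<and> norm (dpow (d + N + 1) \<alpha> y) \<le> B" if y: "y \<in> ?seg" for y
      proof -
        obtain t where t: "0 \<le> t" "t \<le> 1" "y = (1 - t) *\<^sub>R x + t *\<^sub>R (x + sum w S)"
          using y unfolding closed_segment_def by blast
        hence "y = x + of_real t * sum w S"
          by (simp add: scaleR_conv_of_real algebra_simps)
        thus ?thesis using *[OF S t(1,2)] by simp
      qed
      have "norm (dpow (m + 0) \<alpha> (x + sum w S) -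
              (\<Sum>i\<le>d + N - m. dpow (m + i) \<alpha> x * ((x + sum w S) - x) ^ i / fact i))
            \<le> B * norm ((x + sum w S) - x) ^ Suc (d + N - m) / fact (d + N - m)"
      proof (rule complex_Taylor[where S = ?seg and f = "\<lambda>i. dpow (m + i) \<alpha>"])
        fix i y assume "y \<in> ?seg"
        thus "(dpow (m + i) \<alpha> has_field_derivative dpow (m + Suc i) \<alpha> y) (at y within ?seg)"
          using dpow_deriv seg by (auto intro: has_field_derivative_at_within)
      next
        fix y assume "y \<in> ?seg"
        thus "norm (dpow (m + Suc (d + N - m)) \<alpha> y) \<le> B"
          using seg m by auto
      qed auto
      thus ?thesis by (simp add: e_def tay_def)
    qed
    have "(\<Sum>m\<le>N. \<Sum>S\<in>Pow {1..d}. ?b m * ?sg S * tay m S) =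
          (\<Sum>m\<le>N. \<Sum>i\<le>d + N - m. ?b m * dpow (m + i) \<alpha> x * ?D i)"
      unfolding tay_def sum_distrib_left fps_nth_diff_fps mixed_diff_def sum_divide_distrib
      by (subst sum.swap, intro sum.cong refl) (simp add: mult_ac)
    \<comment> \<open>For m > N the index i stays below d, where the coefficients vanish; so the sum
      extends to the full triangle m + i \<le> d + N.\<close>
    also have "?D i = 0" if "i < d" for i
      unfolding fps_nth_diff_fps mixed_diff_power_0[OF that] by simp
    hence "(\<Sum>m\<le>N. \<Sum>i\<le>d + N - m. ?b m * dpow (m + i) \<alpha> x * ?D i) =
           (\<Sum>m\<le>d + N. \<Sum>i\<le>d + N - m. ?b m * dpow (m + i) \<alpha> x * ?D i)"
      by (intro sum.mono_neutral_left) (auto intro!: sum.neutral)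
    also have "\<dots> = (\<Sum>(m, i)\<in>{(m, i). m + i \<le> d + N}. ?b m * dpow (m + i) \<alpha> x * ?D i)"
      by (subst sum.Sigma) (auto intro!: sum.cong)
    also have "\<dots> = (\<Sum>K\<le>d + N. \<Sum>m\<le>K. ?b m * dpow (m + (K - m)) \<alpha> x * ?D (K - m))"
      by (rule sum.triangle_reindex_eq)
    also have "\<dots> = (\<Sum>K\<le>d + N. dpow K \<alpha> x * (\<Sum>m\<le>K. ?b m * ?D (K - m)))"
      unfolding sum_distrib_left by (intro sum.cong refl) simp
    also have "\<dots> = (\<Sum>K\<le>d + N. if K = d then dpow d \<alpha> x else 0)"
      by (intro sum.cong refl, subst bcoeff_convolution) (use w_nz in auto)
    also have "\<dots> = dpow d \<alpha> x" by simp
    finally have main: "(\<Sum>m\<le>N. \<Sum>S\<in>Pow {1..d}. ?b m * ?sg S * tay m S) = dpow d \<alpha> x" .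
    have "mixed_diff {1..d} w (antidiff N \<alpha>) x = (\<Sum>m\<le>N. \<Sum>S\<in>Pow {1..d}. ?b m * ?sg S * dpow m \<alpha> (x + sum w S))"
      unfolding antidiff_def[abs_def] mixed_diff_sum unfolding mixed_diff_def sum_distrib_left
      by (simp add: mult_ac)
    also have "\<dots> = (\<Sum>m\<le>N. \<Sum>S\<in>Pow {1..d}. ?b m * ?sg S * tay m S + ?b m * ?sg S * e m S)"
      by (intro sum.cong refl) (simp add: e_def algebra_simps)
    also have "\<dots> = dpow d \<alpha> x + (\<Sum>m\<le>N. \<Sum>S\<in>Pow {1..d}. ?b m * ?sg S * e m S)"
      by (simp only: sum.distrib main)
    finally have "norm (dpow d \<alpha> x - mixed_diff {1..d} w (antidiff N \<alpha>) x) =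
        norm (\<Sum>m\<le>N. \<Sum>S\<in>Pow {1..d}. ?b m * ?sg S * e m S)"
      by simp
    also have "\<dots> \<le> (\<Sum>m\<le>N. \<Sum>S\<in>Pow {1..d}. c m S * B)"
    proof (intro sum_norm_le)
      fix m S assume "m \<in> {..N}" "S \<in> Pow {1..d}"
      hence "norm (?b m) * norm (e m S) \<le>
             norm (?b m) * (B * norm (sum w S) ^ Suc (d + N - m) / fact (d + N - m))"
        using e_bound by (intro mult_left_mono) auto
      thus "norm (?b m * ?sg S * e m S) \<le> c m S * B"
        by (simp add: c_def norm_mult norm_power mult_ac)
    qed
    also have "\<dots> = C * B"
      by (simp only: C_def sum_distrib_right)
    finally show ?thesis .
  qed
  moreover have "C \<ge> 0"
    by (auto simp: C_def c_def intro!: sum_nonneg)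
  ultimately show ?thesis using that by blast
qed

text \<open>Going from M to M + 1 adds one shell to the cube sum, and by
  \<open>mixed_diff_shell\<close> the correction changes by the mixed differences over the same
  shell. Each step is thus a sum of local errors.\<close>

lemma approx_step:
  "approx N (Suc M) \<alpha> - approx N M \<alpha> =
     (\<Sum>n\<in>shell d M. dpow d \<alpha> (dot d n w) - mixed_diff {1..d} w (antidiff N \<alpha>) (dot d n w))"
  unfolding sum_subtractf mixed_diff_shell
  by (simp add: approx_def sum_cube_shells dpow_def sum_distrib_left [symmetric] distrib_left)

text \<open>The real part of \<open>s\<close> gives the power of \<open>Suc M\<close>; the deviation
  of \<open>l\<close> from the real logarithm, including its imaginary part, costs only a bounded
  factor.\<close>

lemma norm_exp_bound:
  assumes "norm (l - of_real (ln (real (Suc M)))) \<le> \<Lambda>"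
  shows "norm (exp (s * l)) \<le> exp (norm s * \<Lambda>) * real (Suc M) powr Re s"
proof -
  define \<delta> where "\<delta> = l - of_real (ln (real (Suc M)))"
  have "Re (s * \<delta>) \<le> norm (s * \<delta>)" by (rule complex_Re_le_cmod)
  also have "\<dots> \<le> norm s * \<Lambda>"
    using assms by (simp add: norm_mult mult_left_mono \<delta>_def)
  finally have *: "Re (s * \<delta>) \<le> norm s * \<Lambda>" .
  have "s * l = s * \<delta> + s * of_real (ln (real (Suc M)))"
    by (simp add: \<delta>_def algebra_simps)
  hence "Re (s * l) = Re (s * \<delta>) + Re s * ln (real (Suc M))"
    by simp
  hence "norm (exp (s * l)) = exp (Re (s * \<delta>)) * real (Suc M) powr Re s"
    by (simp add: powr_def exp_add mult_ac)
  also have "\<dots> \<le> exp (norm s * \<Lambda>) * real (Suc M) powr Re s"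
    using * by (intro mult_right_mono) auto
  finally show ?thesis .
qed

lemma card_shell_le_powr: "real (card (shell d M)) \<le> d * 2 ^ (d - 1) * real (Suc M) powr (real d - 1)"
proof -
  have "real (card (shell d M)) \<le> real (d * (M + 2) ^ (d - 1))"
    using card_shell_le of_nat_le_iff by blast
  also have "\<dots> \<le> d * (2 * real (Suc M)) ^ (d - 1)"
    by (auto intro!: mult_left_mono power_mono)
  also have "\<dots> = d * 2 ^ (d - 1) * real (Suc M) ^ (d - 1)"
    by (simp only: power_mult_distrib mult.assoc of_nat_mult of_nat_power of_nat_numeral)
  also have "real (Suc M) ^ (d - 1) = real (Suc M) powr real (d - 1)"
    by (subst powr_realpow) auto
  also have "real (d - 1) = real d - 1"
    using d_pos by simp
  finally show ?thesis .
qed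

text \<open>A shell has order M^(d-1) points and each error has order M^(-N-1-\<sigma>). The
  constant is uniform in \<alpha> within the given bounds.\<close>

lemma approx_step_bound:
  obtains K where "K \<ge> 0"
    "\<And>\<alpha> M. norm \<alpha> \<le> A \<Longrightarrow> Re \<alpha> \<ge> \<sigma> \<Longrightarrow>
       norm (approx N (Suc M) \<alpha> - approx N M \<alpha>) \<le> K * real (Suc M) powr (real d - 2 - real N - \<sigma>)"
proof -
  obtain C where C: "C \<ge> 0"
    "\<And>\<alpha> x B. (\<And>S t. S \<subseteq> {1..d} \<Longrightarrow> 0 \<le> t \<Longrightarrow> t \<le> 1 \<Longrightarrow>
        x + of_real t * sum w S \<in> H \<and> norm (dpow (d + N + 1) \<alpha> (x + of_real t * sum w S)) \<le> B) \<Longrightarrow>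
      norm (dpow d \<alpha> x - mixed_diff {1..d} w (antidiff N \<alpha>) x) \<le> C * B"
    using remainder_bound[of N] by blast
  obtain \<Lambda> where \<Lambda>: "\<Lambda> \<ge> 0"
    "\<And>M n S t. n \<in> shell d M \<Longrightarrow> S \<subseteq> {1..d} \<Longrightarrow> 0 \<le> t \<Longrightarrow> t \<le> 1 \<Longrightarrow>
       dot d n w + of_real t * sum w S \<in> H \<and>
       norm (L (dot d n w + of_real t * sum w S) - of_real (ln (real (Suc M)))) \<le> \<Lambda>"
    using L_bound by blast
  define Kp where "Kp = (\<Prod>j<d + N + 1. real d + real j + \<bar>A\<bar>)"
  define K1 where "K1 = Kp * exp ((real N + 1 + \<bar>A\<bar>) * \<Lambda>)"
  define K where "K = d * 2 ^ (d - 1) * C * K1"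
  have Kp: "Kp \<ge> 0" unfolding Kp_def by (intro prod_nonneg) auto
  have "norm (approx N (Suc M) \<alpha> - approx N M \<alpha>) \<le> K * real (Suc M) powr (real d - 2 - real N - \<sigma>)"
    if \<alpha>: "norm \<alpha> \<le> A" "Re \<alpha> \<ge> \<sigma>" for \<alpha> M
  proof -
    let ?B = "K1 * real (Suc M) powr (- (real N + 1 + \<sigma>))"
    have B: "norm (dpow (d + N + 1) \<alpha> y) \<le> ?B"
      if y: "norm (L y - of_real (ln (real (Suc M)))) \<le> \<Lambda>" for y
    proof -
      let ?s = "of_nat d - of_nat (d + N + 1) - \<alpha>"
      have "norm (falling (d + N + 1) \<alpha>) \<le> Kp"
        unfolding falling_def Kp_def prod_norm [symmetric]
      proof (intro prod_mono conjI)
        fix j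
        have "norm (of_nat d - of_nat j - \<alpha>) \<le> norm (of_nat d :: complex) + norm (of_nat j :: complex) + norm \<alpha>"
          by (meson norm_triangle_ineq4 order_trans add_right_mono)
        also have "\<dots> \<le> real d + real j + \<bar>A\<bar>"
          using \<alpha> by simp
        finally show "norm (of_nat d - of_nat j - \<alpha>) \<le> real d + real j + \<bar>A\<bar>" .
      qed auto
      moreover have "norm (exp (?s * L y)) \<le>
          exp ((real N + 1 + \<bar>A\<bar>) * \<Lambda>) * real (Suc M) powr (- (real N + 1 + \<sigma>))"
      proof -
        have "?s = - (of_nat (N + 1) + \<alpha>)" by simp
        hence "norm ?s \<le> norm (of_nat (N + 1) :: complex) + norm \<alpha>"
          by (metis norm_minus_cancel norm_triangle_ineq)
        also have "\<dots> \<le> real N + 1 + \<bar>A\<bar>"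
          using \<alpha> by (simp only: norm_of_nat)
        finally have 1: "norm ?s \<le> real N + 1 + \<bar>A\<bar>" .
        have "norm (exp (?s * L y)) \<le> exp (norm ?s * \<Lambda>) * real (Suc M) powr Re ?s"
          by (rule norm_exp_bound[OF y])
        also have "\<dots> \<le> exp ((real N + 1 + \<bar>A\<bar>) * \<Lambda>) * real (Suc M) powr (- (real N + 1 + \<sigma>))"
          using 1 \<alpha> \<Lambda>(1) by (intro mult_mono powr_mono) (auto intro: mult_right_mono)
        finally show ?thesis .
      qed
      ultimately show ?thesis
        unfolding dpow_def norm_mult K1_def mult.assoc using Kp by (intro mult_mono) auto
    qed
    have "norm (approx N (Suc M) \<alpha> - approx N M \<alpha>) \<le> (\<Sum>n\<in>shell d M. C * ?B)"
      unfolding approx_step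
    proof (intro sum_norm_le C(2))
      fix n S t assume "n \<in> shell d M" "S \<subseteq> {1..d}" "0 \<le> t" "t \<le> (1::real)"
      from \<Lambda>(2)[OF this] B
      show "dot d n w + of_real t * sum w S \<in> H \<and>
            norm (dpow (d + N + 1) \<alpha> (dot d n w + of_real t * sum w S)) \<le> ?B" by blast
    qed
    also have "\<dots> = real (card (shell d M)) * (C * ?B)" by simp
    also have "\<dots> \<le> (d * 2 ^ (d - 1) * real (Suc M) powr (real d - 1)) * (C * ?B)"
      using C(1) Kp by (intro mult_right_mono card_shell_le_powr) (auto simp: K1_def)
    also have "\<dots> = K * (real (Suc M) powr (real d - 1) * real (Suc M) powr (- (real N + 1 + \<sigma>)))"
      by (simp add: K_def)
    also have "real (Suc M) powr (real d - 1) * real (Suc M) powr (- (real N + 1 + \<sigma>)) =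
               real (Suc M) powr (real d - 2 - real N - \<sigma>)"
      unfolding powr_add [symmetric] by (simp add: algebra_simps)
    finally show ?thesis .
  qed
  moreover have "K \<ge> 0"
    using C(1) Kp by (auto simp: K_def K1_def)
  ultimately show ?thesis using that by blast
qed

section \<open>Locally uniform convergence of the approximations\<close>

lemma approx_holomorphic: "approx N M holomorphic_on A"
  unfolding approx_def[abs_def] alt_subset_sum_def antidiff_def dpow_def falling_def
  by (intro holomorphic_intros)

definition approx_lim :: "nat \<Rightarrow> complex \<Rightarrow> complex" where
  "approx_lim N \<alpha> = lim (\<lambda>M. approx N M \<alpha>)"

lemma approx_uniform_limit:
  assumes "Re \<alpha>0 > real d - real N - 1"
  obtains r where "r > 0" "cball \<alpha>0 r \<subseteq> {\<alpha>. Re \<alpha> > real d - real N - 1}"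
    "uniform_limit (cball \<alpha>0 r) (approx N) (approx_lim N) sequentially"
proof -
  \<comment> \<open>Half the distance to the boundary line. On the disc Re \<alpha> stays above
    \<sigma>, for which the exponent in the step bound is -1 - r, so the telescoping series passes
    the Weierstrass test.\<close>
  define r where "r = (Re \<alpha>0 - (real d - real N - 1)) / 2"
  define \<sigma> where "\<sigma> = real d - real N - 1 + r"
  have r: "r > 0" using assms by (simp add: r_def)
  have \<sigma>: "Re \<alpha> \<ge> \<sigma>" if "\<alpha> \<in> cball \<alpha>0 r" for \<alpha>
  proof -
    have "Re \<alpha>0 - Re \<alpha> \<le> r"
      using that complex_Re_le_cmod[of "\<alpha>0 - \<alpha>"] by (simp add: dist_norm)
    thus ?thesis by (simp add: \<sigma>_def r_def field_simps)
  qed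
  have A: "norm \<alpha> \<le> norm \<alpha>0 + r" if "\<alpha> \<in> cball \<alpha>0 r" for \<alpha>
    using that norm_triangle_ineq2[of \<alpha> \<alpha>0] by (simp add: dist_norm norm_minus_commute)
  obtain K where K: "K \<ge> 0"
    "\<And>\<alpha> M. norm \<alpha> \<le> norm \<alpha>0 + r \<Longrightarrow> Re \<alpha> \<ge> \<sigma> \<Longrightarrow>
       norm (approx N (Suc M) \<alpha> - approx N M \<alpha>) \<le> K * real (Suc M) powr (real d - 2 - real N - \<sigma>)"
    using approx_step_bound[of "norm \<alpha>0 + r" \<sigma> N] by blast
  have "summable (\<lambda>M. K * real (Suc M) powr (real d - 2 - real N - \<sigma>))"
    using r by (intro summable_mult, subst summable_Suc_iff)
               (simp add: summable_real_powr_iff \<sigma>_def)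
  from Weierstrass_m_test'[OF _ this] K(2)[OF A \<sigma>]
  have "uniformly_convergent_on (cball \<alpha>0 r) (\<lambda>n \<alpha>. \<Sum>M<n. approx N (Suc M) \<alpha> - approx N M \<alpha>)" .
  moreover have "(\<Sum>M<n. approx N (Suc M) \<alpha> - approx N M \<alpha>) = approx N n \<alpha> - approx N 0 \<alpha>" for n \<alpha>
    by (rule sum_lessThan_telescope)
  ultimately have "uniformly_convergent_on (cball \<alpha>0 r) (\<lambda>n \<alpha>. approx N n \<alpha> - approx N 0 \<alpha>)"
    by simp
  then obtain l where "uniform_limit (cball \<alpha>0 r) (\<lambda>n \<alpha>. approx N n \<alpha> - approx N 0 \<alpha>) l sequentially"
    by (auto simp: uniformly_convergent_on_def)
  hence "uniform_limit (cball \<alpha>0 r) (\<lambda>n \<alpha>. approx N n \<alpha> - approx N 0 \<alpha> + approx N 0 \<alpha>) (\<lambda>\<alpha>. l \<alpha> + approx N 0 \<alpha>) sequentially"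
    by (intro uniform_limit_intros)
  hence ul: "uniform_limit (cball \<alpha>0 r) (approx N) (\<lambda>\<alpha>. l \<alpha> + approx N 0 \<alpha>) sequentially"
    by simp
  have "approx_lim N \<alpha> = l \<alpha> + approx N 0 \<alpha>" if "\<alpha> \<in> cball \<alpha>0 r" for \<alpha>
    using tendsto_uniform_limitI[OF ul that] unfolding approx_lim_def by (rule limI)
  hence "uniform_limit (cball \<alpha>0 r) (approx N) (approx_lim N) sequentially"
    using ul by (subst uniform_limit_cong') auto
  moreover have "cball \<alpha>0 r \<subseteq> {\<alpha>. Re \<alpha> > real d - real N - 1}"
    using \<sigma> r by (fastforce simp: \<sigma>_def)
  ultimately show ?thesis using that r by blast
qed

lemma approx_tendsto:
  assumes "Re \<alpha> > real d - real N - 1"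
  shows "(\<lambda>M. approx N M \<alpha>) \<longlonglongrightarrow> approx_lim N \<alpha>"
proof -
  obtain r where r: "r > 0" "uniform_limit (cball \<alpha> r) (approx N) (approx_lim N) sequentially"
    using approx_uniform_limit[OF assms] by blast
  show ?thesis
    using tendsto_uniform_limitI[OF r(2)] r(1) by auto
qed

lemma open_right_half_plane: "open {\<alpha> :: complex. Re \<alpha> > c}"
  by (intro open_Collect_less continuous_intros)

lemma approx_lim_holomorphic: "approx_lim N holomorphic_on {\<alpha>. Re \<alpha> > real d - real N - 1}"
proof (rule holomorphic_uniform_sequence[OF open_right_half_plane approx_holomorphic])
  fix \<alpha> assume "\<alpha> \<in> {\<alpha>. Re \<alpha> > real d - real N - 1}"
  thus "\<exists>r>0. cball \<alpha> r \<subseteq> {\<alpha>. Re \<alpha> > real d - real N - 1} \<and>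
          uniform_limit (cball \<alpha> r) (approx N) (approx_lim N) sequentially"
    using approx_uniform_limit[of N \<alpha>] by blast
qed

section \<open>The meromorphic continuation\<close>

lemma dpow_scale_tendsto_0:
  assumes "x \<in> H" "Re \<alpha> > real d - real m"
  shows "(\<lambda>M. dpow m \<alpha> (of_nat (Suc M) * x)) \<longlonglongrightarrow> 0"
proof -
  let ?s = "of_nat d - of_nat m - \<alpha>"
  have "filterlim (\<lambda>M. real (Suc M)) at_top sequentially"
    by (rule filterlim_compose[OF filterlim_real_sequentially filterlim_Suc])
  hence "(\<lambda>M. real (Suc M) powr Re ?s) \<longlonglongrightarrow> 0"
    by (intro tendsto_neg_powr) (use assms in auto)
  moreover have "norm (exp (?s * of_real (ln (real (Suc M))))) = real (Suc M) powr Re ?s" for M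
    by (simp add: powr_def)
  ultimately have "(\<lambda>M. norm (exp (?s * of_real (ln (real (Suc M)))))) \<longlonglongrightarrow> 0"
    by simp
  hence "(\<lambda>M. exp (?s * of_real (ln (real (Suc M))))) \<longlonglongrightarrow> 0"
    by (rule tendsto_norm_zero_cancel)
  hence "(\<lambda>M. dpow m \<alpha> x * exp (?s * of_real (ln (real (Suc M))))) \<longlonglongrightarrow> 0"
    by (rule tendsto_mult_right_zero)
  moreover have "dpow m \<alpha> (of_nat (Suc M) * x) = dpow m \<alpha> x * exp (?s * of_real (ln (real (Suc M))))" for M
    using L_scale[OF assms(1), of "real (Suc M)"]
    by (simp add: dpow_def distrib_left exp_add del: of_nat_Suc)
  ultimately show ?thesis by simp
qed

lemma alt_subset_sum_scale_tendsto_0: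
  assumes "\<And>x. x \<in> H \<Longrightarrow> (\<lambda>M. g (of_nat (Suc M) * x)) \<longlonglongrightarrow> 0"
  shows "(\<lambda>M. alt_subset_sum d g (\<lambda>i. of_nat (Suc M) * w i)) \<longlonglongrightarrow> 0"
  unfolding alt_subset_sum_def
proof (intro tendsto_null_sum tendsto_mult_right_zero)
  fix S assume "S \<in> Pow {1..d} - {{}}"
  thus "(\<lambda>M. g (\<Sum>i\<in>S. of_nat (Suc M) * w i)) \<longlonglongrightarrow> 0"
    unfolding sum_distrib_left [symmetric] by (intro assms sum_w_in) auto
qed

text \<open>The two approximations differ by the correction terms with N < m \<le> N', and each has
  an exponent of negative real part in the given range.\<close>

lemma approx_lim_mono_eq:
  assumes "N \<le> N'" and \<alpha>: "Re \<alpha> > real d - real N - 1"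
  shows "approx_lim N' \<alpha> = approx_lim N \<alpha>"
proof -
  let ?g = "\<lambda>x. antidiff N' \<alpha> x - antidiff N \<alpha> x"
  have "(\<lambda>M. alt_subset_sum d ?g (\<lambda>i. of_nat (Suc M) * w i)) \<longlonglongrightarrow> 0"
  proof (rule alt_subset_sum_scale_tendsto_0)
    fix x assume x: "x \<in> H"
    have "?g y = (\<Sum>m\<in>{N<..N'}. bcoeff d w m * dpow m \<alpha> y)" for y
    proof -
      have "{..N'} = {..N} \<union> {N<..N'}" using assms by auto
      hence "antidiff N' \<alpha> y = (\<Sum>m\<in>{..N} \<union> {N<..N'}. bcoeff d w m * dpow m \<alpha> y)"
        by (simp add: antidiff_def)
      also have "\<dots> = antidiff N \<alpha> y + (\<Sum>m\<in>{N<..N'}. bcoeff d w m * dpow m \<alpha> y)"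
        unfolding antidiff_def by (intro sum.union_disjoint) auto
      finally show ?thesis by simp
    qed
    moreover have "(\<lambda>M. \<Sum>m\<in>{N<..N'}. bcoeff d w m * dpow m \<alpha> (of_nat (Suc M) * x)) \<longlonglongrightarrow> 0"
      by (intro tendsto_null_sum tendsto_mult_right_zero dpow_scale_tendsto_0 x) (use \<alpha> in auto)
    ultimately show "(\<lambda>M. ?g (of_nat (Suc M) * x)) \<longlonglongrightarrow> 0" by simp
  qed
  moreover have "approx N M \<alpha> - approx N' M \<alpha> = alt_subset_sum d ?g (\<lambda>i. of_nat (Suc M) * w i)" for M
    unfolding approx_def alt_subset_sum_def right_diff_distrib sum_subtractf by simp
  ultimately have "(\<lambda>M. approx N M \<alpha> - approx N' M \<alpha>) \<longlonglongrightarrow> 0" by simp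
  moreover have "(\<lambda>M. approx N M \<alpha> - approx N' M \<alpha>) \<longlonglongrightarrow> approx_lim N \<alpha> - approx_lim N' \<alpha>"
    using assms by (intro tendsto_diff approx_tendsto) auto
  ultimately have "0 = approx_lim N \<alpha> - approx_lim N' \<alpha>"
    by (rule LIMSEQ_unique)
  thus ?thesis by simp
qed

lemma Re_gt_index_bound: "real d - real (d + nat \<lceil>norm \<alpha>\<rceil>) - 1 < Re \<alpha>"
  using abs_Re_le_cmod[of \<alpha>] real_nat_ceiling_ge[of "norm \<alpha>"] unfolding of_nat_add by linarith

text \<open>The index is merely one that is large enough at \<alpha>; every admissible index gives
  the same value by \<open>approx_lim_mono_eq\<close>.\<close>

definition continuation :: "complex \<Rightarrow> complex" where
  "continuation \<alpha> = approx_lim (d + nat \<lceil>norm \<alpha>\<rceil>) \<alpha>"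

lemma continuation_eq:
  assumes "Re \<alpha> > real d - real N - 1"
  shows "continuation \<alpha> = approx_lim N \<alpha>"
proof -
  let ?N = "d + nat \<lceil>norm \<alpha>\<rceil>"
  have "real d - real ?N - 1 < Re \<alpha>"
    by (rule Re_gt_index_bound)
  thus ?thesis
    using approx_lim_mono_eq[of N ?N \<alpha>] approx_lim_mono_eq[of ?N N \<alpha>] assms
    unfolding continuation_def by (cases "N \<le> ?N") auto
qed

text \<open>The index varies with the point, but around a given point it can be frozen on a whole
  half-plane, where \<open>approx_lim_holomorphic\<close> applies.\<close>

lemma continuation_analytic: "continuation analytic_on A"
proof -
  have "continuation analytic_on {\<alpha>}" for \<alpha>
  proof -
    define N where "N = d + nat \<lceil>norm \<alpha>\<rceil>"
    let ?U = "{\<alpha>. Re \<alpha> > real d - real N - 1}"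
    have "\<alpha> \<in> ?U"
      unfolding N_def using Re_gt_index_bound by blast
    moreover have "continuation holomorphic_on ?U"
      using approx_lim_holomorphic by (rule holomorphic_transform) (simp add: continuation_eq)
    ultimately show ?thesis
      unfolding analytic_at by (intro exI[of _ ?U] conjI open_right_half_plane)
  qed
  thus ?thesis
    by (subst analytic_on_analytic_at) simp
qed

text \<open>Shell M contributes order M^(d-1-Re \<alpha>), which is summable, and each finite set of
  tuples lies in a cube, that is, in finitely many shells and the origin.\<close>

lemma summable_Barnes:
  assumes "Re \<alpha> > real d"
  shows "(\<lambda>n. exp (- \<alpha> * L (dot d n w))) summable_on (nat_tuples d - {zero_tuple d})"
proof (rule abs_summable_summable, rule nonneg_bdd_above_summable_on)
  let ?f = "\<lambda>n. norm (exp (- \<alpha> * L (dot d n w)))"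
  obtain \<Lambda> where \<Lambda>: "\<Lambda> \<ge> 0"
    "\<And>M n S t. n \<in> shell d M \<Longrightarrow> S \<subseteq> {1..d} \<Longrightarrow> 0 \<le> t \<Longrightarrow> t \<le> 1 \<Longrightarrow>
       dot d n w + of_real t * sum w S \<in> H \<and>
       norm (L (dot d n w + of_real t * sum w S) - of_real (ln (real (Suc M)))) \<le> \<Lambda>"
    using L_bound by blast
  define K where "K = exp (norm \<alpha> * \<Lambda>)"
  define K' where "K' = d * 2 ^ (d - 1) * K"
  let ?b = "\<lambda>M. K' * real (Suc M) powr (real d - 1 - Re \<alpha>)"
  have shell: "sum ?f (shell d M) \<le> ?b M" for M
  proof -
    have "?f n \<le> K * real (Suc M) powr (- Re \<alpha>)" if "n \<in> shell d M" for n
    proof -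
      have "norm (L (dot d n w) - of_real (ln (real (Suc M)))) \<le> \<Lambda>"
        using \<Lambda>(2)[OF that, of "{}" 0] by simp
      from norm_exp_bound[OF this, of "- \<alpha>"] show ?thesis by (simp add: K_def)
    qed
    hence "sum ?f (shell d M) \<le> (\<Sum>n\<in>shell d M. K * real (Suc M) powr (- Re \<alpha>))"
      by (rule sum_mono)
    also have "\<dots> = real (card (shell d M)) * (K * real (Suc M) powr (- Re \<alpha>))"
      by simp
    also have "\<dots> \<le> (d * 2 ^ (d - 1) * real (Suc M) powr (real d - 1)) * (K * real (Suc M) powr (- Re \<alpha>))"
      by (intro mult_right_mono card_shell_le_powr) (auto simp: K_def)
    also have "\<dots> = K' * (real (Suc M) powr (real d - 1) * real (Suc M) powr (- Re \<alpha>))"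
      by (simp add: K'_def)
    also have "real (Suc M) powr (real d - 1) * real (Suc M) powr (- Re \<alpha>) =
               real (Suc M) powr (real d - 1 - Re \<alpha>)"
      unfolding powr_add [symmetric] by simp
    finally show ?thesis .
  qed
  have summ: "summable ?b"
    using assms by (intro summable_mult, subst summable_Suc_iff) (simp add: summable_real_powr_iff)
  show "bdd_above (sum ?f ` {F. F \<subseteq> nat_tuples d - {zero_tuple d} \<and> finite F})"
  proof (rule bdd_aboveI2)
    fix F assume "F \<in> {F. F \<subseteq> nat_tuples d - {zero_tuple d} \<and> finite F}"
    hence F: "F \<subseteq> nat_tuples d - {zero_tuple d}" "finite F" by auto
    hence "eventually (\<lambda>M. F \<subseteq> cube d M) sequentially"
      by (intro eventually_subset_cube) auto
    then obtain M where M: "F \<subseteq> cube d M"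
      by (auto simp: eventually_sequentially)
    have "sum ?f F \<le> sum ?f (cube d M - {zero_tuple d})"
      using F M by (intro sum_mono2) auto
    also have "\<dots> \<le> (\<Sum>k<M. ?b k)"
      unfolding sum_cube_shells by (intro sum_mono shell)
    also have "\<dots> \<le> suminf ?b"
      using summ by (intro sum_le_suminf) (auto simp: K'_def K_def)
    finally show "sum ?f F \<le> suminf ?b" .
  qed
qed auto

text \<open>Index N = 0 is admissible here, and its only correction term, a power with exponent d -
  \<alpha>, tends to 0.\<close>

lemma continuation_eq_infsum:
  assumes "Re \<alpha> > real d"
  shows "continuation \<alpha> = falling d \<alpha> *
           (\<Sum>\<^sub>\<infinity>n\<in>nat_tuples d - {zero_tuple d}. exp (- \<alpha> * L (dot d n w)))"
proof -
  let ?f = "\<lambda>n. exp (- \<alpha> * L (dot d n w))"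
  let ?A = "nat_tuples d - {zero_tuple d}"
  have "(sum ?f \<longlongrightarrow> infsum ?f ?A) (finite_subsets_at_top ?A)"
    using has_sum_infsum[OF summable_Barnes[OF assms]] by (simp add: has_sum_def)
  hence "(\<lambda>M. sum ?f (cube d M - {zero_tuple d})) \<longlonglongrightarrow> infsum ?f ?A"
    using filterlim_cube by (rule filterlim_compose)
  moreover have "(\<lambda>M. alt_subset_sum d (antidiff 0 \<alpha>) (\<lambda>i. of_nat (Suc M) * w i)) \<longlonglongrightarrow> 0"
    unfolding antidiff_def[abs_def]
    by (intro alt_subset_sum_scale_tendsto_0 tendsto_null_sum tendsto_mult_right_zero
              dpow_scale_tendsto_0) (use assms in auto)
  ultimately have "(\<lambda>M. approx 0 M \<alpha>) \<longlonglongrightarrow> falling d \<alpha> * infsum ?f ?A - 0"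
    unfolding approx_def by (intro tendsto_intros)
  moreover have "(\<lambda>M. approx 0 M \<alpha>) \<longlonglongrightarrow> continuation \<alpha>"
    using approx_tendsto[of 0 \<alpha>] continuation_eq[of 0 \<alpha>] assms by simp
  ultimately have "falling d \<alpha> * infsum ?f ?A - 0 = continuation \<alpha>"
    by (rule LIMSEQ_unique)
  thus ?thesis by simp
qed

section \<open>Division by the factor vanishing at 1 to d\<close>

lemma falling_eq_0_iff: "falling d \<alpha> = 0 \<longleftrightarrow> (\<exists>j<d. \<alpha> = of_nat (d - j))"
  unfolding falling_def by (auto simp: of_nat_diff)

lemma falling_nonzero_of_Re_gt: "Re \<alpha> > real d \<Longrightarrow> falling d \<alpha> \<noteq> 0"
  by (auto simp: falling_eq_0_iff)

lemma falling_0_nonzero: "falling d 0 \<noteq> 0"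
  unfolding falling_eq_0_iff by (auto simp del: of_nat_diff)

lemma falling_analytic: "falling k analytic_on A"
  unfolding falling_def[abs_def] by (intro analytic_intros)

text \<open>The quotient agrees with the series for Re \<alpha> > d; \<open>remove_sings\<close>
  makes it nicely meromorphic, and uniqueness resolves the \<open>THE\<close>.\<close>

lemma barnes_zeta_h_eq: "barnes_zeta_h L d w = remove_sings (\<lambda>\<alpha>. continuation \<alpha> / falling d \<alpha>)"
proof -
  let ?Z = "remove_sings (\<lambda>\<alpha>. continuation \<alpha> / falling d \<alpha>)"
  let ?S = "\<lambda>\<alpha>. (\<Sum>\<^sub>\<infinity>n\<in>nat_tuples d - {zero_tuple d}. exp (- \<alpha> * L (dot d n w)))"
  have mero: "?Z nicely_meromorphic_on UNIV"
    by (intro remove_sings_nicely_meromorphic meromorphic_on_divide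
              analytic_on_imp_meromorphic_on continuation_analytic falling_analytic)
  have eq: "?Z \<alpha> = ?S \<alpha>" if "Re \<alpha> > real d" for \<alpha>
  proof -
    have "(\<lambda>\<alpha>. continuation \<alpha> / falling d \<alpha>) analytic_on {\<alpha>}"
      using falling_nonzero_of_Re_gt[OF that]
      by (intro analytic_on_divide continuation_analytic falling_analytic) auto
    thus ?thesis
      using falling_nonzero_of_Re_gt[OF that] by (simp add: continuation_eq_infsum[OF that])
  qed
  have ne: "{\<alpha> :: complex. Re \<alpha> > real d} \<noteq> {}"
    by (auto intro!: exI[of _ "of_real (real d + 1)"])
  show ?thesis
    unfolding barnes_zeta_h_def
  proof (rule the_equality)
    show "?Z nicely_meromorphic_on UNIV \<and> (\<forall>\<alpha>. Re \<alpha> > real d \<longrightarrow> ?Z \<alpha> = ?S \<alpha>)"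
      using mero eq by blast
  next
    fix Y assume Y: "Y nicely_meromorphic_on UNIV \<and> (\<forall>\<alpha>. Re \<alpha> > real d \<longrightarrow> Y \<alpha> = ?S \<alpha>)"
    show "Y = ?Z"
    proof (rule nicely_meromorphic_unique[OF _ mero _ open_right_half_plane ne])
      show "Y nicely_meromorphic_on UNIV" using Y by blast
    next
      fix \<alpha> assume "\<alpha> \<in> {\<alpha>. Re \<alpha> > real d}"
      hence "Re \<alpha> > real d" by simp
      thus "Y \<alpha> = ?Z \<alpha>" using Y eq[of \<alpha>] by metis
    qed
  qed
qed

text \<open>With N = d the convergence is uniform near 0, so derivatives of the holomorphic
  approximations converge too; the quotient rule handles the nonvanishing factor
  \<open>falling d\<close>.\<close>

lemma deriv_barnes_zeta_h_0:
  "(\<lambda>M. deriv (\<lambda>\<alpha>. approx d M \<alpha> / falling d \<alpha>) 0) \<longlonglongrightarrow> deriv (barnes_zeta_h L d w) 0"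
proof -
  have falling_diff: "falling d field_differentiable at 0"
    by (rule analytic_on_imp_differentiable_at[OF falling_analytic[of d UNIV]]) simp
  have "(\<lambda>\<alpha>. continuation \<alpha> / falling d \<alpha>) analytic_on {0}"
    using falling_0_nonzero by (intro analytic_on_divide continuation_analytic falling_analytic) auto
  hence "deriv (barnes_zeta_h L d w) 0 = deriv (\<lambda>\<alpha>. continuation \<alpha> / falling d \<alpha>) 0"
    by (simp add: barnes_zeta_h_eq)
  also have "\<dots> = (deriv continuation 0 * falling d 0 - continuation 0 * deriv (falling d) 0) / falling d 0 ^ 2"
    by (intro deriv_divide falling_diff falling_0_nonzero
              analytic_on_imp_differentiable_at[OF continuation_analytic[of UNIV]]) simp
  finally have *: "deriv (barnes_zeta_h L d w) 0 = \<dots>" .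
  obtain r where r: "r > 0" "cball 0 r \<subseteq> {\<alpha>. Re \<alpha> > real d - real d - 1}"
    "uniform_limit (cball 0 r) (approx d) (approx_lim d) sequentially"
    using approx_uniform_limit[of d 0] by auto
  have eq: "continuation \<alpha> = approx_lim d \<alpha>" if "\<alpha> \<in> ball 0 r" for \<alpha>
  proof -
    have "\<alpha> \<in> {\<alpha>. Re \<alpha> > real d - real d - 1}"
      by (rule subsetD[OF r(2)]) (use that in auto)
    thus ?thesis by (intro continuation_eq) simp
  qed
  have "uniform_limit (ball 0 r) (approx d) (approx_lim d) sequentially"
    using r(3) by (rule uniform_limit_on_subset) auto
  hence ul: "uniform_limit (ball 0 r) (approx d) continuation sequentially"
    using eq by (subst uniform_limit_cong') auto
  have "(\<lambda>M. (deriv ^^ 1) (approx d M) 0) \<longlonglongrightarrow> (deriv ^^ 1) continuation 0"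
    using r(1) by (intro higher_deriv_complex_uniform_limit[OF ul] always_eventually allI approx_holomorphic) auto
  moreover have "(\<lambda>M. approx d M 0) \<longlonglongrightarrow> continuation 0"
    using tendsto_uniform_limitI[OF ul, of 0] r(1) by auto
  ultimately have "(\<lambda>M. (deriv (approx d M) 0 * falling d 0 - approx d M 0 * deriv (falling d) 0) / falling d 0 ^ 2) \<longlonglongrightarrow>
      (deriv continuation 0 * falling d 0 - continuation 0 * deriv (falling d) 0) / falling d 0 ^ 2"
    using falling_0_nonzero by (intro tendsto_intros) auto
  moreover have "deriv (\<lambda>\<alpha>. approx d M \<alpha> / falling d \<alpha>) 0 =
      (deriv (approx d M) 0 * falling d 0 - approx d M 0 * deriv (falling d) 0) / falling d 0 ^ 2" for M
    by (intro deriv_divide falling_diff falling_0_nonzero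
              holomorphic_on_imp_differentiable_at[OF approx_holomorphic[of d M UNIV]]) simp_all
  ultimately show ?thesis
    unfolding * by simp
qed

section \<open>The derivative at the origin\<close>

text \<open>The factor left on the power with exponent k - \<alpha> after division by
  \<open>falling d \<alpha>\<close>; see \<open>falling_div_falling\<close>.\<close>

definition recip_prod :: "nat \<Rightarrow> complex \<Rightarrow> complex" where
  "recip_prod k \<alpha> = (\<Prod>i<k. inverse (of_nat (Suc i) - \<alpha>))"

lemma recip_prod_Suc: "recip_prod (Suc k) \<alpha> = recip_prod k \<alpha> * inverse (of_nat (Suc k) - \<alpha>)"
  by (simp add: recip_prod_def)

lemma recip_prod_0: "recip_prod k 0 = 1 / fact k"
proof (induction k)
  case (Suc k)
  have "recip_prod (Suc k) 0 = 1 / fact k * inverse (of_nat (Suc k) - 0)"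
    by (simp only: recip_prod_Suc Suc.IH)
  also have "\<dots> = 1 / fact (Suc k)"
    by (simp add: field_simps)
  finally show ?case .
qed (simp add: recip_prod_def)

text \<open>The logarithmic derivative at 0 is the sum of 1 / i for i up to k. This is where
  harmonic numbers arise.\<close>

lemma recip_prod_deriv_0: "(recip_prod k has_field_derivative harm k / fact k) (at 0)"
proof (induction k)
  case 0
  show ?case by (simp add: recip_prod_def[abs_def] harm_def)
next
  case (Suc k)
  have "((\<lambda>\<alpha>. recip_prod k \<alpha> * inverse (of_nat (Suc k) - \<alpha>)) has_field_derivative
          harm k / fact k * inverse (of_nat (Suc k)) + 1 / fact k * inverse (of_nat (Suc k) ^ 2)) (at 0)"
    using Suc.IH
    by (auto intro!: derivative_eq_intros simp: recip_prod_0 field_simps power2_eq_square simp del: of_nat_Suc)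
  moreover have "(\<lambda>\<alpha>. recip_prod k \<alpha> * inverse (of_nat (Suc k) - \<alpha>)) = recip_prod (Suc k)"
    by (intro ext recip_prod_Suc [symmetric])
  moreover have "harm k / fact k * inverse (of_nat (Suc k)) + 1 / fact k * inverse (of_nat (Suc k) ^ 2) =
      (harm (Suc k) / fact (Suc k) :: complex)"
    by (simp add: harm_Suc field_simps power2_eq_square del: of_nat_Suc)
  ultimately show ?case by simp
qed

lemma falling_div_falling:
  assumes "falling d \<alpha> \<noteq> 0" "k \<le> d"
  shows "falling (d - k) \<alpha> / falling d \<alpha> = recip_prod k \<alpha>"
  using assms(2)
proof (induction k)
  case 0
  thus ?case using assms by (simp add: recip_prod_def)
next
  case (Suc k)
  have "d - k = Suc (d - Suc k)" using Suc.prems by simp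
  moreover have "(of_nat d - of_nat (d - Suc k) - \<alpha> :: complex) = of_nat (Suc k) - \<alpha>"
    using Suc.prems by (simp add: of_nat_diff del: of_nat_Suc)
  ultimately have eq: "falling (d - k) \<alpha> = falling (d - Suc k) \<alpha> * (of_nat (Suc k) - \<alpha>)"
    by (simp add: falling_def del: of_nat_Suc)
  have "of_nat (Suc k) - \<alpha> \<noteq> 0"
  proof
    assume "of_nat (Suc k) - \<alpha> = 0"
    hence "\<alpha> = of_nat (d - (d - Suc k))" using Suc.prems by simp
    thus False
      using assms(1) Suc.prems unfolding falling_eq_0_iff
      by (metis Suc_le_lessD diff_less zero_less_Suc order.strict_trans2)
  qed
  moreover have "recip_prod (Suc k) \<alpha> = falling (d - Suc k) \<alpha> * (of_nat (Suc k) - \<alpha>) / falling d \<alpha> * inverse (of_nat (Suc k) - \<alpha>)"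
    using Suc eq by (simp only: recip_prod_Suc)
  ultimately show ?case
    by (simp only: divide_inverse mult_ac) (simp add: mult.assoc [symmetric] del: of_nat_Suc)
qed

text \<open>After division the m-th correction term is \<open>recip_prod (d - m) \<alpha>\<close>
  times a power; the product rule at 0 yields the harmonic number from the first factor and
  \<open>- L x\<close> from the second.\<close>

lemma deriv_approx_div_falling_0:
  "deriv (\<lambda>\<alpha>. approx d M \<alpha> / falling d \<alpha>) 0 =
     - (\<Sum>n\<in>cube d M - {zero_tuple d}. L (dot d n w))
     - alt_subset_sum d (\<lambda>x. \<Sum>m\<le>d. bcoeff d w m / fact (d - m) * (harm (d - m) - L x) * x ^ (d - m))
         (\<lambda>i. of_nat (Suc M) * w i)"
proof -
  let ?v = "\<lambda>i. of_nat (Suc M) * w i"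
  let ?g = "\<lambda>\<alpha> x. \<Sum>m\<le>d. bcoeff d w m * (recip_prod (d - m) \<alpha> * exp ((of_nat (d - m) - \<alpha>) * L x))"
  let ?g' = "\<lambda>x. \<Sum>m\<le>d. bcoeff d w m / fact (d - m) * (harm (d - m) - L x) * x ^ (d - m)"
  let ?F = "\<lambda>\<alpha>. (\<Sum>n\<in>cube d M - {zero_tuple d}. exp (- \<alpha> * L (dot d n w))) - alt_subset_sum d (?g \<alpha>) ?v"
  have "approx d M \<alpha> / falling d \<alpha> = ?F \<alpha>" if "falling d \<alpha> \<noteq> 0" for \<alpha>
  proof -
    have "antidiff d \<alpha> x / falling d \<alpha> = ?g \<alpha> x" for x
    proof -
      have "falling m \<alpha> / falling d \<alpha> = recip_prod (d - m) \<alpha>" if "m \<le> d" for m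
        using falling_div_falling[OF \<open>falling d \<alpha> \<noteq> 0\<close>, of "d - m"] that by simp
      note ratio = this
      have "bcoeff d w m * dpow m \<alpha> x / falling d \<alpha> =
             bcoeff d w m * (recip_prod (d - m) \<alpha> * exp ((of_nat (d - m) - \<alpha>) * L x))" if "m \<le> d" for m
      proof -
        have "bcoeff d w m * dpow m \<alpha> x / falling d \<alpha> =
              bcoeff d w m * ((falling m \<alpha> / falling d \<alpha>) * exp ((of_nat (d - m) - \<alpha>) * L x))"
          using that by (simp add: dpow_def)
        thus ?thesis unfolding ratio[OF that] .
      qed
      thus ?thesis
        unfolding antidiff_def sum_divide_distrib by (intro sum.cong refl) auto
    qed
    hence "alt_subset_sum d (antidiff d \<alpha>) ?v / falling d \<alpha> = alt_subset_sum d (?g \<alpha>) ?v"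
      unfolding alt_subset_sum_def sum_divide_distrib times_divide_eq_right [symmetric] by simp
    thus ?thesis
      using that by (simp add: approx_def diff_divide_distrib)
  qed
  \<comment> \<open>The rewriting is valid only off the zeros of \<open>falling d\<close>; a
    neighbourhood of 0 suffices for the derivative there.\<close>
  moreover have "eventually (\<lambda>\<alpha>. falling d \<alpha> \<noteq> 0) (nhds 0)"
  proof (rule tendsto_imp_eventually_ne[OF _ falling_0_nonzero])
    show "(falling d \<longlongrightarrow> falling d 0) (nhds 0)"
      using analytic_at_imp_isCont[OF falling_analytic[of d "{0}"]]
      by (simp add: isCont_def tendsto_at_iff_tendsto_nhds)
  qed
  ultimately have "eventually (\<lambda>\<alpha>. approx d M \<alpha> / falling d \<alpha> = ?F \<alpha>) (nhds 0)"
    by (auto elim: eventually_mono)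
  hence "deriv (\<lambda>\<alpha>. approx d M \<alpha> / falling d \<alpha>) 0 = deriv ?F 0"
    by (rule deriv_cong_ev) simp
  also have "deriv ?F 0 = - (\<Sum>n\<in>cube d M - {zero_tuple d}. L (dot d n w)) - alt_subset_sum d ?g' ?v"
  proof (rule DERIV_imp_deriv, rule DERIV_diff)
    have "((\<lambda>\<alpha>. \<Sum>n\<in>cube d M - {zero_tuple d}. exp (- \<alpha> * L (dot d n w))) has_field_derivative
            (\<Sum>n\<in>cube d M - {zero_tuple d}. - L (dot d n w))) (at 0)"
      by (intro DERIV_sum) (auto intro!: derivative_eq_intros)
    thus "((\<lambda>\<alpha>. \<Sum>n\<in>cube d M - {zero_tuple d}. exp (- \<alpha> * L (dot d n w))) has_field_derivative
            - (\<Sum>n\<in>cube d M - {zero_tuple d}. L (dot d n w))) (at 0)"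
      by (simp add: sum_negf)
    have g': "((\<lambda>\<alpha>. ?g \<alpha> x) has_field_derivative ?g' x) (at 0)" if "x \<in> H" for x
    proof (rule DERIV_sum)
      fix m
      have e: "exp (of_nat (d - m) * L x) = x ^ (d - m)"
        by (simp only: exp_of_nat_mult exp_L[OF that])
      have "((\<lambda>\<alpha>. recip_prod (d - m) \<alpha> * exp ((of_nat (d - m) - \<alpha>) * L x)) has_field_derivative
          (harm (d - m) / fact (d - m) * x ^ (d - m) + 1 / fact (d - m) * (- L x * x ^ (d - m)))) (at 0)"
        using recip_prod_deriv_0[of "d - m"]
        by (auto intro!: derivative_eq_intros simp: recip_prod_0 e simp del: of_nat_diff)
      from DERIV_cmult[OF this, of "bcoeff d w m"]
      show "((\<lambda>\<alpha>. bcoeff d w m * (recip_prod (d - m) \<alpha> * exp ((of_nat (d - m) - \<alpha>) * L x))) has_field_derivative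
          bcoeff d w m / fact (d - m) * (harm (d - m) - L x) * x ^ (d - m)) (at 0)"
        by (simp add: field_simps)
    qed
    show "((\<lambda>\<alpha>. alt_subset_sum d (?g \<alpha>) ?v) has_field_derivative alt_subset_sum d ?g' ?v) (at 0)"
      unfolding alt_subset_sum_def
    proof (rule DERIV_sum, rule DERIV_cmult, rule g')
      fix S assume "S \<in> Pow {1..d} - {{}}"
      hence "of_real (real (Suc M)) * sum w S \<in> H"
        by (intro half_plane_scale sum_w_in) auto
      thus "(\<Sum>i\<in>S. of_nat (Suc M) * w i) \<in> H"
        by (simp add: sum_distrib_left del: of_nat_Suc)
    qed
  qed
  finally show ?thesis .
qed

text \<open>Substituting L(M' x) = ln M' + L(x), with M' = M + 1, separates the terms with
  \<open>L\<close> from plain powers of x, most of which the alternating sum annihilates.\<close>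

lemma alt_subset_sum_antidiff_deriv:
  "- alt_subset_sum d (\<lambda>x. \<Sum>m\<le>d. bcoeff d w m / fact (d - m) * (harm (d - m) - L x) * x ^ (d - m))
       (\<lambda>i. of_nat (Suc M) * w i) =
     of_nat (Suc M) ^ d * (of_real (ln (real (Suc M))) - harm d)
     + (\<Sum>m=0..d. bernoullian_coeff d w m / (fact m * fact (d - m))
               * alt_subset_sum d (\<lambda>x. x ^ (d - m) * L x) w * of_nat (Suc M) ^ (d - m))
     + (-1) ^ (d - 1) * (bernoullian_coeff d w d / fact d) * of_real (ln (real (Suc M)))"
proof -
  define M' :: complex where "M' = of_nat (Suc M)"
  define l :: complex where "l = of_real (ln (real (Suc M)))"
  let ?b = "bcoeff d w" and ?W = "\<Prod>i=1..d. w i"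
  let ?c = "\<lambda>m. ?b m / fact (d - m) * M' ^ (d - m)"
  let ?F = "\<lambda>g. alt_subset_sum d g w"
  have "- alt_subset_sum d (\<lambda>x. \<Sum>m\<le>d. ?b m / fact (d - m) * (harm (d - m) - L x) * x ^ (d - m)) (\<lambda>i. M' * w i)
      = (\<Sum>S\<in>Pow {1..d} - {{}}. \<Sum>m\<le>d. ?c m * ((-1) ^ (d - card S) * (sum w S ^ (d - m) * L (sum w S))
           + (l - harm (d - m)) * ((-1) ^ (d - card S) * sum w S ^ (d - m))))"
    unfolding alt_subset_sum_def sum_negf [symmetric]
  proof (intro sum.cong refl)
    fix S assume S: "S \<in> Pow {1..d} - {{}}"
    have L: "L (M' * sum w S) = l + L (sum w S)"
      using L_scale[of "sum w S" "real (Suc M)"] sum_w_in[of S] S by (simp add: M'_def l_def)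
    have sum: "(\<Sum>i\<in>S. M' * w i) = M' * sum w S"
      by (rule sum_distrib_left [symmetric])
    show "- ((-1) ^ (d - card S) * (\<Sum>m\<le>d. ?b m / fact (d - m) *
             (harm (d - m) - L (\<Sum>i\<in>S. M' * w i)) * (\<Sum>i\<in>S. M' * w i) ^ (d - m)))
      = (\<Sum>m\<le>d. ?c m * ((-1) ^ (d - card S) * (sum w S ^ (d - m) * L (sum w S))
           + (l - harm (d - m)) * ((-1) ^ (d - card S) * sum w S ^ (d - m))))"
      unfolding sum L unfolding sum_distrib_left [of "(-1) ^ (d - card S)"] sum_negf [symmetric]
      by (intro sum.cong refl) (simp add: power_mult_distrib algebra_simps add_divide_distrib)
  qed
  also have "\<dots> = (\<Sum>m\<le>d. ?c m * (?F (\<lambda>x. x ^ (d - m) * L x) + (l - harm (d - m)) * ?F (\<lambda>x. x ^ (d - m))))"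
    unfolding alt_subset_sum_def
    by (subst sum.swap) (simp only: sum.distrib sum_distrib_left distrib_left)
  also have "\<dots> = (\<Sum>m\<le>d. ?c m * ?F (\<lambda>x. x ^ (d - m) * L x))
                + (\<Sum>m\<le>d. ?c m * (l - harm (d - m)) * ?F (\<lambda>x. x ^ (d - m)))"
    by (simp add: sum.distrib distrib_left mult.assoc)
  \<comment> \<open>Only x^d (m = 0) and x^0 (m = d) survive. They give the leading term with
    \<open>harm d\<close> and, since \<open>harm 0\<close> is 0, the lone logarithmic term.\<close>
  also have "(\<Sum>m\<le>d. ?c m * (l - harm (d - m)) * ?F (\<lambda>x. x ^ (d - m))) =
             (\<Sum>m\<in>{0, d}. ?c m * (l - harm (d - m)) * ?F (\<lambda>x. x ^ (d - m)))"
    by (intro sum.mono_neutral_right) (auto simp: alt_subset_sum_power d_pos)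
  also have "\<dots> = ?b 0 * ?W * M' ^ d * (l - harm d) + ?b d * l * (-1) ^ (d - 1)"
    using d_pos by (simp add: alt_subset_sum_power harm_def)
  also have "?b 0 * ?W = 1"
    by (rule bcoeff_0) (rule w_nz)
  finally have "- alt_subset_sum d (\<lambda>x. \<Sum>m\<le>d. ?b m / fact (d - m) * (harm (d - m) - L x) * x ^ (d - m)) (\<lambda>i. M' * w i)
      = (\<Sum>m\<le>d. ?c m * ?F (\<lambda>x. x ^ (d - m) * L x)) + (M' ^ d * (l - harm d) + ?b d * l * (-1) ^ (d - 1))"
    by simp
  moreover have "(\<Sum>m=0..d. bernoullian_coeff d w m / (fact m * fact (d - m)) * ?F (\<lambda>x. x ^ (d - m) * L x) * M' ^ (d - m))
      = (\<Sum>m\<le>d. ?c m * ?F (\<lambda>x. x ^ (d - m) * L x))"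
    unfolding atLeast0AtMost by (intro sum.cong refl) (simp add: bernoullian_coeff_eq[OF d_pos])
  ultimately show ?thesis
    by (simp add: M'_def [symmetric] l_def [symmetric] bernoullian_coeff_eq[OF d_pos] mult_ac del: of_nat_Suc)
qed

end

theorem mainTheorem8:
  fixes \<theta> :: real and L :: "complex \<Rightarrow> complex" and d :: nat and w :: "nat \<Rightarrow> complex"
  assumes "log_branch L (half_plane \<theta>)"
    and "d \<ge> 1"
    and "\<And>i. i \<in> {1..d} \<Longrightarrow> w i \<in> half_plane \<theta>"
  shows "(\<lambda>M::nat.
            of_nat M ^ d * (of_real (ln (real M)) - harm d)
          + (\<Sum>m=0..d. bernoullian_coeff d w m / (fact m * fact (d - m))
               * alt_subset_sum d (\<lambda>x. x ^ (d - m) * L x) w * of_nat M ^ (d - m))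
          + (-1) ^ (d - 1) * (bernoullian_coeff d w d / fact d) * of_real (ln (real M))
          - (\<Sum>n\<in>cube d (M - 1) - {zero_tuple d}. L (dot d n w)))
         \<longlonglongrightarrow> deriv (barnes_zeta_h L d w) 0"
    (is "?X \<longlonglongrightarrow> _")
proof -
  interpret barnes \<theta> L d w
    using assms by unfold_locales auto
  \<comment> \<open>The cube in the statement has entries up to M - 1, so its index M + 1 matches
    \<open>approx d M\<close>.\<close>
  have "?X (Suc M) = deriv (\<lambda>\<alpha>. approx d M \<alpha> / falling d \<alpha>) 0" for M
    unfolding deriv_approx_div_falling_0 alt_subset_sum_antidiff_deriv [symmetric] by simp
  hence "(\<lambda>M. ?X (Suc M)) \<longlonglongrightarrow> deriv (barnes_zeta_h L d w) 0"
    using deriv_barnes_zeta_h_0 by simp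
  thus ?thesis
    by (rule LIMSEQ_imp_Suc)
qed

end
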